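(* Let $\mathcal{A}$ be a dual Banach algebra, let $\varphi$ be a weak$^*$-continuous character on $\mathcal{A}$, and let $I$ be a finite totally ordered set. Then $UP(I,\mathcal{A})$ is Johnson pseudo-Connes amenable if and only if $\mathcal{A}$ is Johnson pseudo-Connes amenable and $|I|=1$.
   Context: $UP(I,\mathcal{A})=\{[a_{i,j}]_{i,j\in I}: a_{i,j}\in\mathcal{A},\ a_{i,j}=0 \text{ for } i>j\}$ is the algebra of $I\times I$ upper triangular matrices over $\mathcal{A}$ with usual matrix operations and norm $\|[a_{i,j}]\|=\sum_{i,j}\|a_{i,j}\|$; for finite $I$ it is a dual Banach algebra with predual the corresponding finite $\ell^\infty$-direct sum of copies of $\mathcal{A}_*$ (entrywise pairing). A dual Banach algebra is a Banach algebra $\mathcal{A}$ with a closed $\mathcal{A}$-submodule $\mathcal{A}_*$ of $\mathcal{A}^*$ such that $\mathcal{A}=(\mathcal{A}_* )^*$. For a bimodule $E$, $\sigma wc(E)$ is the set of $x\in E$ for which $a\mapsto a\cdot x$, $a\mapsto x\cdot a$ are weak$^*$-weak continuous. $\mathcal{A}\hat{\otimes}\mathcal{A}$ has actions $a\cdot(b\otimes c)=ab\otimes c$, $(b\otimes c)\cdot a=b\otimes ca$; duals carry the dual actions. $\pi_{\mathcal{A}}$ is the multiplication map $\mathcal{A}\hat{\otimes}\mathcal{A}\to\mathcal{A}$, $i_{\mathcal{A}_*}:\mathcal{A}_*\hookrightarrow\mathcal{A}^*$ the canonical embedding. A dual Banach algebra $\mathcal{A}$ is Johnson pseudo-Connes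 amenable if there is a (not necessarily bounded) net $(m_\alpha)$ in $(\mathcal{A}\hat{\otimes}\mathcal{A})^{**}$ with $\langle T,a\cdot m_\alpha\rangle=\langle T,m_\alpha\cdot a\rangle$ for all $a\in\mathcal{A}$, $T\in\sigma wc((\mathcal{A}\hat{\otimes}\mathcal{A})^* )$, $\alpha$, and $i_{\mathcal{A}_*}^*\pi_{\mathcal{A}}^{**}(m_\alpha)a\to a$ for every $a\in\mathcal{A}$. *)

theory Defs
  imports "HOL-Analysis.Analysis" "HOL-Library.Function_Algebras"
begin

text \<open>A complex Banach algebra is given by a carrier set inside an ambient additive
  group, a complex scalar multiplication, a multiplication, a norm and (for dual Banach
  algebras) a distinguished set of functionals, the predual.\<close>

record 'a cba =
  carrier :: "'a set"
  smult :: "complex \<Rightarrow> 'a \<Rightarrow> 'a"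
  mult :: "'a \<Rightarrow> 'a \<Rightarrow> 'a"
  nrm :: "'a \<Rightarrow> real"
  predual :: "('a \<Rightarrow> complex) set"

definition cbanach_algebra :: "('a::ab_group_add, 'b) cba_scheme \<Rightarrow> bool" where
  "cbanach_algebra A \<longleftrightarrow>
     0 \<in> carrier A \<and>
     (\<forall>x\<in>carrier A. \<forall>y\<in>carrier A. x + y \<in> carrier A \<and> - x \<in> carrier A
        \<and> mult A x y \<in> carrier A) \<and>
     (\<forall>c. \<forall>x\<in>carrier A. smult A c x \<in> carrier A) \<and>
     (\<forall>c d. \<forall>x\<in>carrier A. \<forall>y\<in>carrier A.
        smult A c (x + y) = smult A c x + smult A c y \<and>
        smult A (c + d) x = smult A c x + smult A d x \<and>
        smult A (c * d) x = smult A c (smult A d x) \<and>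
        smult A 1 x = x) \<and>
     (\<forall>c. \<forall>x\<in>carrier A. \<forall>y\<in>carrier A. \<forall>z\<in>carrier A.
        mult A (mult A x y) z = mult A x (mult A y z) \<and>
        mult A (x + y) z = mult A x z + mult A y z \<and>
        mult A x (y + z) = mult A x y + mult A x z \<and>
        mult A (smult A c x) y = smult A c (mult A x y) \<and>
        mult A x (smult A c y) = smult A c (mult A x y)) \<and>
     (\<forall>c. \<forall>x\<in>carrier A. \<forall>y\<in>carrier A.
        0 \<le> nrm A x \<and> (nrm A x = 0 \<longleftrightarrow> x = 0) \<and>
        nrm A (x + y) \<le> nrm A x + nrm A y \<and>
        nrm A (smult A c x) = cmod c * nrm A x \<and>
        nrm A (mult A x y) \<le> nrm A x * nrm A y) \<and>
     (\<forall>X::nat \<Rightarrow> 'a. (\<forall>n. X n \<in> carrier A) \<longrightarrow>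
        (\<forall>e>0. \<exists>N. \<forall>m\<ge>N. \<forall>n\<ge>N. nrm A (X m - X n) < e) \<longrightarrow>
        (\<exists>L\<in>carrier A. \<forall>e>0. \<exists>N. \<forall>n\<ge>N. nrm A (X n - L) < e))"

definition blf :: "'v::ab_group_add set \<Rightarrow> (complex \<Rightarrow> 'v \<Rightarrow> 'v) \<Rightarrow> ('v \<Rightarrow> real)
    \<Rightarrow> ('v \<Rightarrow> complex) \<Rightarrow> bool" where
  "blf S sm N f \<longleftrightarrow>
     (\<forall>x\<in>S. \<forall>y\<in>S. f (x + y) = f x + f y) \<and>
     (\<forall>c. \<forall>x\<in>S. f (sm c x) = c * f x) \<and>
     (\<exists>K. \<forall>x\<in>S. cmod (f x) \<le> K * N x)"

definition dnorm :: "('a, 'b) cba_scheme \<Rightarrow> ('a \<Rightarrow> complex) \<Rightarrow> real" where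
  "dnorm A f = Sup {cmod (f x) | x. x \<in> carrier A \<and> nrm A x \<le> 1}"

definition fsmult :: "complex \<Rightarrow> ('a \<Rightarrow> complex) \<Rightarrow> ('a \<Rightarrow> complex)" where
  "fsmult c f = (\<lambda>x. c * f x)"

definition dual_space :: "('a::ab_group_add, 'b) cba_scheme \<Rightarrow> ('a \<Rightarrow> complex) set" where
  "dual_space A = {f. blf (carrier A) (smult A) (nrm A) f \<and> (\<forall>x. x \<notin> carrier A \<longrightarrow> f x = 0)}"

text \<open>Dual Banach algebra: the predual is a norm-closed \<open>A\<close>-submodule of \<open>A\<^sup>*\<close>
  and the canonical map \<open>A \<rightarrow> (A\<^sub>*)\<^sup>*\<close> is an isometric isomorphism.\<close>
definition dual_banach_algebra :: "('a::ab_group_add, 'b) cba_scheme \<Rightarrow> bool" where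
  "dual_banach_algebra A \<longleftrightarrow>
     cbanach_algebra A \<and>
     predual A \<subseteq> dual_space A \<and>
     0 \<in> predual A \<and>
     (\<forall>f\<in>predual A. \<forall>g\<in>predual A. f + g \<in> predual A) \<and>
     (\<forall>c. \<forall>f\<in>predual A. fsmult c f \<in> predual A) \<and>
     (\<forall>f\<in>dual_space A. (\<forall>e>0. \<exists>g\<in>predual A. dnorm A (f - g) < e) \<longrightarrow> f \<in> predual A) \<and>
     (\<forall>f\<in>predual A. \<forall>a\<in>carrier A.
        (\<lambda>b. if b \<in> carrier A then f (mult A b a) else 0) \<in> predual A \<and>
        (\<lambda>b. if b \<in> carrier A then f (mult A a b) else 0) \<in> predual A) \<and>
     (\<forall>a\<in>carrier A. nrm A a = Sup {cmod (f a) | f. f \<in> predual A \<and> dnorm A f \<le> 1}) \<and>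
     (\<forall>\<Phi>. blf (predual A) fsmult (dnorm A) \<Phi> \<longrightarrow>
        (\<exists>a\<in>carrier A. \<forall>f\<in>predual A. \<Phi> f = f a))"

definition wstar_top :: "('a, 'b) cba_scheme \<Rightarrow> 'a topology" where
  "wstar_top A = topology_generated_by
     {{x \<in> carrier A. f x \<in> U} | f U. f \<in> predual A \<and> open U}"

definition character :: "('a::ab_group_add, 'b) cba_scheme \<Rightarrow> ('a \<Rightarrow> complex) \<Rightarrow> bool" where
  "character A \<phi> \<longleftrightarrow>
     (\<forall>x\<in>carrier A. \<forall>y\<in>carrier A. \<phi> (x + y) = \<phi> x + \<phi> y \<and> \<phi> (mult A x y) = \<phi> x * \<phi> y) \<and>
     (\<forall>c. \<forall>x\<in>carrier A. \<phi> (smult A c x) = c * \<phi> x) \<and>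
     (\<exists>x\<in>carrier A. \<phi> x \<noteq> 0)"

section \<open>\<open>(A \<hat>\<otimes> A)\<^sup>*\<close> as bounded bilinear forms, and \<open>(A \<hat>\<otimes> A)\<^sup>*\<^sup>*\<close>\<close>

definition bilin :: "('a::ab_group_add, 'b) cba_scheme \<Rightarrow> ('a \<Rightarrow> 'a \<Rightarrow> complex) set" where
  "bilin A = {T.
     (\<forall>b c. \<not> (b \<in> carrier A \<and> c \<in> carrier A) \<longrightarrow> T b c = 0) \<and>
     (\<forall>b\<in>carrier A. \<forall>b'\<in>carrier A. \<forall>c\<in>carrier A. \<forall>s.
        T (b + b') c = T b c + T b' c \<and> T c (b + b') = T c b + T c b' \<and>
        T (smult A s b) c = s * T b c \<and> T c (smult A s b) = s * T c b) \<and>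
     (\<exists>K. \<forall>b\<in>carrier A. \<forall>c\<in>carrier A. cmod (T b c) \<le> K * nrm A b * nrm A c)}"

definition bnorm :: "('a, 'b) cba_scheme \<Rightarrow> ('a \<Rightarrow> 'a \<Rightarrow> complex) \<Rightarrow> real" where
  "bnorm A T = Sup {cmod (T b c) | b c. b \<in> carrier A \<and> c \<in> carrier A
                                        \<and> nrm A b \<le> 1 \<and> nrm A c \<le> 1}"

definition bsmult :: "complex \<Rightarrow> ('a \<Rightarrow> 'a \<Rightarrow> complex) \<Rightarrow> ('a \<Rightarrow> 'a \<Rightarrow> complex)" where
  "bsmult s T = (\<lambda>b c. s * T b c)"

definition bidual :: "('a::ab_group_add, 'b) cba_scheme \<Rightarrow> (('a \<Rightarrow> 'a \<Rightarrow> complex) \<Rightarrow> complex) set" where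
  "bidual A = {m. blf (bilin A) bsmult (bnorm A) m}"

text \<open>Dual module actions on \<open>(A \<hat>\<otimes> A)\<^sup>*\<close>:
  \<open>\<langle>a\<cdot>T, b\<otimes>c\<rangle> = \<langle>T, b\<otimes>ca\<rangle>\<close> and \<open>\<langle>T\<cdot>a, b\<otimes>c\<rangle> = \<langle>T, ab\<otimes>c\<rangle>\<close>.\<close>
definition lact :: "('a, 'b) cba_scheme \<Rightarrow> 'a \<Rightarrow> ('a \<Rightarrow> 'a \<Rightarrow> complex) \<Rightarrow> ('a \<Rightarrow> 'a \<Rightarrow> complex)" where
  "lact A a T = (\<lambda>b c. if b \<in> carrier A \<and> c \<in> carrier A then T b (mult A c a) else 0)"

definition ract :: "('a, 'b) cba_scheme \<Rightarrow> ('a \<Rightarrow> 'a \<Rightarrow> complex) \<Rightarrow> 'a \<Rightarrow> ('a \<Rightarrow> 'a \<Rightarrow> complex)" where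
  "ract A T a = (\<lambda>b c. if b \<in> carrier A \<and> c \<in> carrier A then T (mult A a b) c else 0)"

definition weak_top :: "('a::ab_group_add, 'b) cba_scheme \<Rightarrow> ('a \<Rightarrow> 'a \<Rightarrow> complex) topology" where
  "weak_top A = topology_generated_by
     {{T \<in> bilin A. m T \<in> U} | m U. m \<in> bidual A \<and> open U}"

definition swc :: "('a::ab_group_add, 'b) cba_scheme \<Rightarrow> ('a \<Rightarrow> 'a \<Rightarrow> complex) set" where
  "swc A = {T \<in> bilin A.
     continuous_map (wstar_top A) (weak_top A) (\<lambda>a. lact A a T) \<and>
     continuous_map (wstar_top A) (weak_top A) (\<lambda>a. ract A T a)}"

text \<open>\<open>\<pi>\<^sup>*\<omega>\<close> as a bilinear form, and \<open>i\<^sup>*\<pi>\<^sup>*\<^sup>*(m) \<in> (A\<^sub>*)\<^sup>* = A\<close>.\<close>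
definition pistar :: "('a, 'b) cba_scheme \<Rightarrow> ('a \<Rightarrow> complex) \<Rightarrow> ('a \<Rightarrow> 'a \<Rightarrow> complex)" where
  "pistar A \<omega> = (\<lambda>b c. if b \<in> carrier A \<and> c \<in> carrier A then \<omega> (mult A b c) else 0)"

definition emap :: "('a, 'b) cba_scheme \<Rightarrow> (('a \<Rightarrow> 'a \<Rightarrow> complex) \<Rightarrow> complex) \<Rightarrow> 'a" where
  "emap A m = (THE a. a \<in> carrier A \<and> (\<forall>\<omega>\<in>predual A. \<omega> a = m (pistar A \<omega>)))"

text \<open>Johnson pseudo-Connes amenability; nets are represented by (proper) filters on
  \<open>(A \<hat>\<otimes> A)\<^sup>*\<^sup>*\<close>, convergence is in norm.\<close>
definition johnson_pseudo_connes_amenable :: "('a::ab_group_add, 'b) cba_scheme \<Rightarrow> bool" where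
  "johnson_pseudo_connes_amenable A \<longleftrightarrow>
     (\<exists>F :: (('a \<Rightarrow> 'a \<Rightarrow> complex) \<Rightarrow> complex) filter.
        F \<noteq> bot \<and>
        eventually (\<lambda>m. m \<in> bidual A \<and>
           (\<forall>a\<in>carrier A. \<forall>T\<in>swc A. m (ract A T a) = m (lact A a T))) F \<and>
        (\<forall>a\<in>carrier A. \<forall>e>0. eventually (\<lambda>m. nrm A (mult A (emap A m) a - a) < e) F))"

definition UP :: "'i::linorder set \<Rightarrow> ('a::ab_group_add, 'b) cba_scheme \<Rightarrow> ('i \<Rightarrow> 'i \<Rightarrow> 'a) cba" where
  "UP I A = \<lparr>
     carrier = {M. \<forall>i j. if i \<in> I \<and> j \<in> I \<and> i \<le> j then M i j \<in> carrier A else M i j = 0},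
     smult = (\<lambda>c M i j. if i \<in> I \<and> j \<in> I \<and> i \<le> j then smult A c (M i j) else 0),
     mult = (\<lambda>M N i j. if i \<in> I \<and> j \<in> I then (\<Sum>k\<in>I. mult A (M i k) (N k j)) else 0),
     nrm = (\<lambda>M. \<Sum>i\<in>I. \<Sum>j\<in>I. nrm A (M i j)),
     predual = {\<Phi>. \<exists>f. (\<forall>i\<in>I. \<forall>j\<in>I. i \<le> j \<longrightarrow> f i j \<in> predual A) \<and>
        \<Phi> = (\<lambda>M. if M \<in> {M. \<forall>i j. if i \<in> I \<and> j \<in> I \<and> i \<le> j then M i j \<in> carrier A else M i j = 0}
                 then (\<Sum>i\<in>I. \<Sum>j\<in>I. if i \<le> j then f i j (M i j) else 0) else 0)} \<rparr>"

end

theory Submission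
  imports Defs
begin

text \<open>
  If \<open>p < n\<close> lie in \<open>I\<close>, put \<open>\<omega>(b) = \<phi>(b\<^sub>n\<^sub>n)\<close>, a weak*-continuous character of \<open>UP(I,A)\<close>, and
  \<open>T(b,c) = \<phi>(b\<^sub>p\<^sub>n) \<omega>(c)\<close>. Since \<open>\<phi>\<close> is multiplicative, \<open>a \<cdot> T\<close> and \<open>T \<cdot> a\<close> are finite sums of
  fixed forms with weak*-continuous coefficients in \<open>a\<close>, so \<open>T\<close> lies in \<open>\<sigma>wc\<close>. For \<open>\<phi>(e) \<noteq> 0\<close> and
  \<open>a = e E\<^sub>p\<^sub>n\<close> one finds \<open>T \<cdot> a = \<phi>(e) \<pi>\<^sup>*\<omega>\<close> but \<open>a \<cdot> T = 0\<close>, hence \<open>\<omega>\<close> vanishes at the image \<open>u\<close> of every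
  admissible \<open>m\<close>. Then \<open>\<omega>(u \<cdot> e E\<^sub>n\<^sub>n) = 0\<close> stays away from \<open>\<omega>(e E\<^sub>n\<^sub>n) = \<phi>(e)\<close>. For a singleton \<open>I\<close>
  the two algebras are isometrically isomorphic, preduals included.
\<close>

section \<open>Linear functionals and bilinear forms\<close>

lemma blf_zero:
  assumes "blf S sm N f" "0 \<in> S"
  shows "f 0 = 0"
proof -
  have "f (0 + 0) = f 0 + f 0"
    using assms unfolding blf_def by blast
  then show ?thesis by simp
qed

lemma blf_sum:
  assumes f: "blf S sm N f" and S: "0 \<in> S" "\<And>x y. x \<in> S \<Longrightarrow> y \<in> S \<Longrightarrow> x + y \<in> S"
    and "finite K" "\<And>k. k \<in> K \<Longrightarrow> g k \<in> S"
  shows "f (sum g K) = (\<Sum>k\<in>K. f (g k)) \<and> sum g K \<in> S"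
  using assms(4,5)
proof (induction K rule: finite_induct)
  case empty
  then show ?case using blf_zero[OF f S(1)] S(1) by simp
next
  case (insert x F)
  moreover have "f (g x + sum g F) = f (g x) + f (sum g F)"
    using f insert unfolding blf_def by blast
  ultimately show ?case using S(2) by simp
qed

section \<open>Bounded bilinear forms\<close>

lemma bilinD:
  assumes "T \<in> bilin A" "b \<in> carrier A" "b' \<in> carrier A" "c \<in> carrier A"
  shows "T (b + b') c = T b c + T b' c" "T c (b + b') = T c b + T c b'"
    "T (smult A s b) c = s * T b c" "T c (smult A s b) = s * T c b"
  using assms unfolding bilin_def by blast+

lemma bilin_outside:
  "T \<in> bilin A \<Longrightarrow> \<not> (b \<in> carrier A \<and> c \<in> carrier A) \<Longrightarrow> T b c = 0"
  unfolding bilin_def by blast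

lemma bilin_bound:
  assumes "T \<in> bilin A"
  shows "\<exists>K. \<forall>b\<in>carrier A. \<forall>c\<in>carrier A. cmod (T b c) \<le> K * nrm A b * nrm A c"
  using assms unfolding bilin_def by blast

lemma bilinI:
  assumes "\<And>b c. \<not> (b \<in> carrier A \<and> c \<in> carrier A) \<Longrightarrow> T b c = 0"
    and "\<And>b b' c. b \<in> carrier A \<Longrightarrow> b' \<in> carrier A \<Longrightarrow> c \<in> carrier A \<Longrightarrow> T (b + b') c = T b c + T b' c"
    and "\<And>b b' c. b \<in> carrier A \<Longrightarrow> b' \<in> carrier A \<Longrightarrow> c \<in> carrier A \<Longrightarrow> T c (b + b') = T c b + T c b'"
    and "\<And>b c s. b \<in> carrier A \<Longrightarrow> c \<in> carrier A \<Longrightarrow> T (smult A s b) c = s * T b c"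
    and "\<And>b c s. b \<in> carrier A \<Longrightarrow> c \<in> carrier A \<Longrightarrow> T c (smult A s b) = s * T c b"
    and "\<And>b c. b \<in> carrier A \<Longrightarrow> c \<in> carrier A \<Longrightarrow> cmod (T b c) \<le> K * nrm A b * nrm A c"
  shows "T \<in> bilin A"
  unfolding bilin_def mem_Collect_eq
  by (intro conjI exI[of _ K] ballI allI impI) (rule assms, assumption+)+

lemma zero_in_bilin: "0 \<in> bilin A"
  by (rule bilinI[where K=0]) auto

lemma bilin_add:
  assumes "S \<in> bilin A" "T \<in> bilin A"
  shows "S + T \<in> bilin A"
proof -
  obtain K where
    K: "\<And>b c. b \<in> carrier A \<Longrightarrow> c \<in> carrier A \<Longrightarrow> cmod (S b c) \<le> K * nrm A b * nrm A c"
    using bilin_bound[OF assms(1)] by blast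
  obtain L where
    L: "\<And>b c. b \<in> carrier A \<Longrightarrow> c \<in> carrier A \<Longrightarrow> cmod (T b c) \<le> L * nrm A b * nrm A c"
    using bilin_bound[OF assms(2)] by blast
  show ?thesis
  proof (rule bilinI[where K="K + L"])
    fix b c assume "b \<in> carrier A" "c \<in> carrier A"
    then show "cmod ((S + T) b c) \<le> (K + L) * nrm A b * nrm A c"
      using norm_triangle_le[OF add_mono[OF K L]] by (simp add: algebra_simps)
  qed (simp_all add: assms[THEN bilinD(1)] assms[THEN bilinD(2)] assms[THEN bilinD(3)]
        assms[THEN bilinD(4)] assms[THEN bilin_outside] algebra_simps)
qed

lemma bilin_bsmult:
  assumes "T \<in> bilin A"
  shows "bsmult s T \<in> bilin A"
proof -
  obtain L where
    L: "\<And>b c. b \<in> carrier A \<Longrightarrow> c \<in> carrier A \<Longrightarrow> cmod (T b c) \<le> L * nrm A b * nrm A c"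
    using bilin_bound[OF assms] by blast
  show ?thesis
  proof (rule bilinI[where K="cmod s * L"])
    fix b c assume "b \<in> carrier A" "c \<in> carrier A"
    then show "cmod (bsmult s T b c) \<le> cmod s * L * nrm A b * nrm A c"
      using mult_left_mono[OF L, of b c "cmod s"]
      by (simp add: bsmult_def norm_mult algebra_simps)
  qed (simp_all add: bsmult_def bilinD[OF assms] bilin_outside[OF assms] algebra_simps)
qed

lemma bilin_product:
  assumes "f \<in> dual_space A" "g \<in> dual_space A"
  shows "(\<lambda>b c. f b * g c) \<in> bilin A"
proof -
  obtain K where K: "\<And>b. b \<in> carrier A \<Longrightarrow> cmod (f b) \<le> K * nrm A b"
    using assms(1) unfolding dual_space_def blf_def by blast
  obtain L where L: "\<And>b. b \<in> carrier A \<Longrightarrow> cmod (g b) \<le> L * nrm A b"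
    using assms(2) unfolding dual_space_def blf_def by blast
  show ?thesis
  proof (rule bilinI[where K="K * L"])
    fix b c assume bc: "b \<in> carrier A" "c \<in> carrier A"
    have "0 \<le> K * nrm A b"
      using K[OF bc(1)] norm_ge_zero order_trans by blast
    then show "cmod (f b * g c) \<le> K * L * nrm A b * nrm A c"
      using mult_mono[OF K[OF bc(1)] L[OF bc(2)]] by (simp add: norm_mult algebra_simps)
  qed (use assms in \<open>auto simp: dual_space_def blf_def algebra_simps\<close>)
qed

section \<open>Functionals on the space of bilinear forms\<close>

lemma bidual_add:
  "m \<in> bidual A \<Longrightarrow> S \<in> bilin A \<Longrightarrow> T \<in> bilin A \<Longrightarrow> m (S + T) = m S + m T"
  unfolding bidual_def blf_def by blast

lemma bidual_bsmult:
  "m \<in> bidual A \<Longrightarrow> T \<in> bilin A \<Longrightarrow> m (bsmult s T) = s * m T"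
  unfolding bidual_def blf_def by blast

lemma bidual_sum:
  assumes "m \<in> bidual A" "finite K" "\<And>k. k \<in> K \<Longrightarrow> S k \<in> bilin A"
  shows "m (\<Sum>k\<in>K. S k) = (\<Sum>k\<in>K. m (S k))" and "(\<Sum>k\<in>K. S k) \<in> bilin A"
  using blf_sum[of "bilin A" bsmult "bnorm A" m K S] assms zero_in_bilin bilin_add
  unfolding bidual_def by blast+

text \<open>Linearity passes through \<open>L\<close>, and the norm bound on \<open>L\<close> gives
  boundedness. The absolute value on the left is there because \<open>bnorm\<close> is a bare
  supremum, with no axioms on \<open>B\<close> to fix its sign, and the constant \<open>K\<close> of
  \<open>m\<close> may be negative.\<close>

lemma bidual_pullback:
  assumes m: "m \<in> bidual B"
    and L: "\<And>T. T \<in> bilin A \<Longrightarrow> L T \<in> bilin B"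
      "\<And>S T. S \<in> bilin A \<Longrightarrow> T \<in> bilin A \<Longrightarrow> L (S + T) = L S + L T"
      "\<And>s T. T \<in> bilin A \<Longrightarrow> L (bsmult s T) = bsmult s (L T)"
      "\<And>T. T \<in> bilin A \<Longrightarrow> \<bar>bnorm B (L T)\<bar> \<le> C * bnorm A T"
  shows "(\<lambda>T. m (L T)) \<in> bidual A"
proof -
  obtain K where K: "\<And>T. T \<in> bilin B \<Longrightarrow> cmod (m T) \<le> K * bnorm B T"
    using m unfolding bidual_def blf_def by blast
  have "cmod (m (L T)) \<le> (\<bar>K\<bar> * C) * bnorm A T" if T: "T \<in> bilin A" for T
  proof -
    have "cmod (m (L T)) \<le> \<bar>K * bnorm B (L T)\<bar>"
      using K[OF L(1)[OF T]] by linarith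
    also have "\<dots> \<le> \<bar>K\<bar> * (C * bnorm A T)"
      unfolding abs_mult by (intro mult_left_mono L(4)[OF T]) simp
    finally show ?thesis by (simp add: algebra_simps)
  qed
  then show ?thesis
    unfolding bidual_def blf_def mem_Collect_eq
    by (intro conjI exI[of _ "\<bar>K\<bar> * C"] ballI allI)
      (simp_all add: L bidual_add[OF m] bidual_bsmult[OF m])
qed

section \<open>The weak* topology\<close>

text \<open>The zero functional with the open set \<open>UNIV\<close> makes the whole carrier a
  subbasic set.\<close>

lemma topspace_wstar: "0 \<in> predual A \<Longrightarrow> topspace (wstar_top A) = carrier A"
  unfolding wstar_top_def topology_generated_by_topspace
  by (auto intro!: exI[of _ "carrier A"] exI[of _ 0] exI[of _ UNIV])

lemma topspace_weak: "topspace (weak_top A) = bilin A"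
proof -
  have "0 \<in> bidual A"
    unfolding bidual_def blf_def by (auto intro!: exI[of _ 0])
  then show ?thesis
    unfolding weak_top_def topology_generated_by_topspace
    by (auto intro!: exI[of _ "bilin A"] exI[of _ 0] exI[of _ UNIV])
qed

lemma predual_wstar_continuous:
  assumes "0 \<in> predual A" "f \<in> predual A"
  shows "continuous_map (wstar_top A) euclidean f"
proof -
  have "openin (wstar_top A) {x \<in> carrier A. f x \<in> U}" if "open U" for U
    unfolding wstar_top_def by (rule topology_generated_by_Basis) (use assms that in blast)
  then show ?thesis
    unfolding continuous_map_def topspace_wstar[OF assms(1)] by auto
qed

text \<open>The weak topology is initial for \<open>bidual A\<close>: the preimage of a subbasic set
  is the preimage of an open set under one of the scalar maps.\<close>

lemma continuous_map_weakI:
  assumes "\<And>x. x \<in> topspace X \<Longrightarrow> G x \<in> bilin A"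
    and "\<And>m. m \<in> bidual A \<Longrightarrow> continuous_map X euclidean (\<lambda>x. m (G x))"
  shows "continuous_map X (weak_top A) G"
  unfolding weak_top_def
proof (rule continuous_on_generated_topo)
  fix W assume "W \<in> {{T \<in> bilin A. m T \<in> U} |m U. m \<in> bidual A \<and> open U}"
  then obtain m U where W: "W = {T \<in> bilin A. m T \<in> U}" "m \<in> bidual A" "open U" by blast
  have "G -` W \<inter> topspace X = {x \<in> topspace X. m (G x) \<in> U}"
    using assms(1) W(1) by auto
  then show "openin X (G -` W \<inter> topspace X)"
    using assms(2)[OF W(2)] W(3) unfolding continuous_map_def by simp
next
  show "G ` topspace X \<subseteq> \<Union> {{T \<in> bilin A. m T \<in> U} |m U. m \<in> bidual A \<and> open U}"
    using assms(1) topspace_weak[of A]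
    unfolding weak_top_def topology_generated_by_topspace by blast
qed

lemma bidual_weak_continuous:
  assumes "m \<in> bidual A"
  shows "continuous_map (weak_top A) euclidean m"
proof -
  have "openin (weak_top A) {x \<in> bilin A. m x \<in> U}" if "open U" for U
    unfolding weak_top_def by (rule topology_generated_by_Basis) (use assms that in blast)
  then show ?thesis
    unfolding continuous_map_def topspace_weak by auto
qed

text \<open>Testing \<open>G\<close> against a functional \<open>m\<close> leaves a finite
  combination of the weak*-continuous \<open>g k\<close> with constants \<open>m (S k)\<close>. This
  is how membership in \<open>swc\<close> is verified for the obstructing form.\<close>

lemma finite_rank_wstar_weak_continuous:
  assumes "0 \<in> predual A" "finite K"
    and "\<And>k. k \<in> K \<Longrightarrow> g k \<in> predual A" and S: "\<And>k. k \<in> K \<Longrightarrow> S k \<in> bilin A"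
    and G: "\<And>a. a \<in> carrier A \<Longrightarrow> G a = (\<Sum>k\<in>K. bsmult (g k a) (S k))"
  shows "continuous_map (wstar_top A) (weak_top A) G"
proof (rule continuous_map_weakI)
  fix a assume "a \<in> topspace (wstar_top A)"
  then have "a \<in> carrier A" by (simp add: topspace_wstar assms)
  moreover have "(\<Sum>k\<in>K. bsmult (g k a) (S k)) \<in> bilin A"
    using assms(2) S
    by (induction K rule: finite_induct) (auto intro: zero_in_bilin bilin_add bilin_bsmult)
  ultimately show "G a \<in> bilin A" by (simp add: G)
next
  fix m assume m: "m \<in> bidual A"
  have "m (G a) = (\<Sum>k\<in>K. g k a * m (S k))" if "a \<in> carrier A" for a
    unfolding G[OF that]
    by (subst bidual_sum(1)[OF m assms(2)]) (auto intro: bilin_bsmult S simp: bidual_bsmult[OF m] S)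
  moreover have "continuous_map (wstar_top A) euclidean (\<lambda>a. g k a * m (S k))" if "k \<in> K" for k
    using continuous_map_compose[OF predual_wstar_continuous[OF assms(1) assms(3)[OF that]],
        of euclidean "\<lambda>z. z * m (S k)"]
    by (simp add: o_def continuous_on_mult_right)
  then have "continuous_map (wstar_top A) euclidean (\<lambda>a. \<Sum>k\<in>K. g k a * m (S k))"
    by (intro continuous_map_sum assms(2))
  ultimately show "continuous_map (wstar_top A) euclidean (\<lambda>a. m (G a))"
    by (subst continuous_map_eq) (auto simp: topspace_wstar assms)
qed

text \<open>The neighbourhoods of a point in a weak topology contain the intersection of finitely many
  level sets, so no quantitative information is needed to identify the continuous functionals.\<close>

lemma wstar_nbhd_contains_level_set:
  assumes "openin (wstar_top A) U" "x \<in> U"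
  shows "\<exists>F. finite F \<and> F \<subseteq> predual A \<and> (\<forall>y\<in>carrier A. (\<forall>f\<in>F. f y = f x) \<longrightarrow> y \<in> U)"
proof -
  have "generate_topology_on {{x \<in> carrier A. f x \<in> U} |f U. f \<in> predual A \<and> open U} U"
    using assms(1) unfolding wstar_top_def openin_topology_generated_by_iff .
  then show ?thesis using assms(2)
  proof (induction rule: generate_topology_on.induct)
    case Empty
    then show ?case by simp
  next
    case (Int U V)
    obtain F where "finite F" "F \<subseteq> predual A" "\<forall>y\<in>carrier A. (\<forall>f\<in>F. f y = f x) \<longrightarrow> y \<in> U"
      using Int.IH(1) Int.prems by blast
    moreover obtain G where "finite G" "G \<subseteq> predual A" "\<forall>y\<in>carrier A. (\<forall>f\<in>G. f y = f x) \<longrightarrow> y \<in> V"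
      using Int.IH(2) Int.prems by blast
    ultimately show ?case by (intro exI[of _ "F \<union> G"]) auto
  next
    case (UN K)
    then obtain k where k: "k \<in> K" "x \<in> k" by blast
    obtain F where "finite F" "F \<subseteq> predual A" "\<forall>y\<in>carrier A. (\<forall>f\<in>F. f y = f x) \<longrightarrow> y \<in> k"
      using UN.IH[OF k] by (elim exE conjE)
    then show ?case using k(1) by (intro exI[of _ F]) (simp add: bexI[of _ k])
  next
    case (Basis S)
    from Basis.hyps obtain f W where "S = {x \<in> carrier A. f x \<in> W}" "f \<in> predual A"
      by (elim CollectE exE conjE)
    then show ?case using Basis.prems by (intro exI[of _ "{f}"]) simp
  qed
qed

text \<open>Induction on \<open>F\<close>, correcting \<phi> by a multiple of one functional at a
  time. With the predual as \<open>V\<close>, the result says that \<phi> agrees on the carrier with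
  a member of the predual.\<close>

lemma vanishing_on_common_kernel_in_span:
  fixes V :: "('a::ab_group_add \<Rightarrow> complex) set"
  assumes S: "\<And>x y. x \<in> S \<Longrightarrow> y \<in> S \<Longrightarrow> x + y \<in> S" "\<And>c x. x \<in> S \<Longrightarrow> sm c x \<in> S"
    and V: "0 \<in> V" "\<And>f g. f \<in> V \<Longrightarrow> g \<in> V \<Longrightarrow> f + g \<in> V" "\<And>c f. f \<in> V \<Longrightarrow> fsmult c f \<in> V"
    and lin: "\<And>f x y. f \<in> V \<Longrightarrow> x \<in> S \<Longrightarrow> y \<in> S \<Longrightarrow> f (x + y) = f x + f y"
      "\<And>f c x. f \<in> V \<Longrightarrow> x \<in> S \<Longrightarrow> f (sm c x) = c * f x"
    and "finite F" "F \<subseteq> V"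
    and "\<And>x y. x \<in> S \<Longrightarrow> y \<in> S \<Longrightarrow> \<phi> (x + y) = \<phi> x + \<phi> y"
      "\<And>c x. x \<in> S \<Longrightarrow> \<phi> (sm c x) = c * \<phi> x"
    and "\<And>x. x \<in> S \<Longrightarrow> (\<forall>f\<in>F. f x = 0) \<Longrightarrow> \<phi> x = 0"
  shows "\<exists>h\<in>V. \<forall>x\<in>S. \<phi> x = h x"
  using assms(8-)
proof (induction F arbitrary: \<phi> rule: finite_induct)
  case empty
  then show ?case using V(1) by (intro bexI[of _ 0]) auto
next
  case (insert g F)
  have g: "g \<in> V" using insert.prems by simp
  show ?case
  proof (cases "\<exists>x0\<in>S. (\<forall>f\<in>F. f x0 = 0) \<and> g x0 \<noteq> 0")
    \<comment> \<open>Here \<open>g\<close> already vanishes on the common zeros of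
      \<open>F\<close>, so the hypothesis for \<open>insert g F\<close> yields the one for
      \<open>F\<close>.\<close>
    case False
    then show ?thesis using insert.prems by (intro insert.IH) auto
  next
    case True
    then obtain x0 where x0: "x0 \<in> S" "\<forall>f\<in>F. f x0 = 0" "g x0 \<noteq> 0" by blast
    \<comment> \<open>This value makes \<phi> - r g vanish at \<open>x0\<close>.\<close>
    define r where "r = \<phi> x0 / g x0"
    have "\<exists>h\<in>V. \<forall>x\<in>S. \<phi> x - r * g x = h x"
    proof (rule insert.IH)
      fix x assume x: "x \<in> S" "\<forall>f\<in>F. f x = 0"
      \<comment> \<open>A multiple of \<open>x0\<close> is subtracted so that
        \<open>g y = 0\<close>, while the functionals in \<open>F\<close> still vanish at
        \<open>y\<close> because they vanish at \<open>x0\<close>.\<close>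
      define y where "y = x + sm (- (g x / g x0)) x0"
      have y: "y \<in> S" unfolding y_def using x x0 S by simp
      have fy: "f y = f x - (g x / g x0) * f x0" if "f \<in> V" for f
        unfolding y_def lin(1)[OF that x(1) S(2)[OF x0(1)]] lin(2)[OF that x0(1)] by simp
      have "f y = 0" if f: "f \<in> insert g F" for f
      proof (cases "f = g")
        case True
        then show ?thesis using fy[OF g] x0(3) by simp
      next
        case False
        then have "f \<in> F" using f by simp
        then show ?thesis using fy[OF subsetD[OF insert.prems(1) f]] 
            bspec[OF x(2), of f] bspec[OF x0(2), of f] by simp
      qed
      then have "\<phi> y = 0" using insert.prems(4) y by blast
      moreover have "\<phi> y = \<phi> x - (g x / g x0) * \<phi> x0"
        unfolding y_def insert.prems(2)[OF x(1) S(2)[OF x0(1)]] insert.prems(3)[OF x0(1)] by simp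
      ultimately show "\<phi> x - r * g x = 0" by (simp add: r_def)
    qed (use insert.prems(1) in \<open>simp_all add: insert.prems(2,3) lin[OF g] algebra_simps\<close>)
    then obtain h where h: "h \<in> V" "\<forall>x\<in>S. \<phi> x - r * g x = h x" by blast
    then show ?thesis
      using V g by (intro bexI[of _ "h + fsmult r g"]) (auto simp: fsmult_def algebra_simps)
  qed
qed

section \<open>Dual Banach algebras\<close>

locale dual_cba =
  fixes A :: "('a::ab_group_add, 'b) cba_scheme"
  assumes dba: "dual_banach_algebra A"
begin

lemma cba: "cbanach_algebra A"
  using dba unfolding dual_banach_algebra_def by blast

lemmas cba_axioms = cba[unfolded cbanach_algebra_def]

lemma zero_closed: "0 \<in> carrier A"
  by (rule cba_axioms[THEN conjunct1])

lemma add_closed: "x \<in> carrier A \<Longrightarrow> y \<in> carrier A \<Longrightarrow> x + y \<in> carrier A"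
  and neg_closed: "x \<in> carrier A \<Longrightarrow> - x \<in> carrier A"
  and mult_closed: "x \<in> carrier A \<Longrightarrow> y \<in> carrier A \<Longrightarrow> mult A x y \<in> carrier A"
  using cba_axioms[THEN conjunct2, THEN conjunct1] by blast+

lemma smult_closed: "x \<in> carrier A \<Longrightarrow> smult A c x \<in> carrier A"
  using cba_axioms[THEN conjunct2, THEN conjunct2, THEN conjunct1] by blast

lemma smult_add: "x \<in> carrier A \<Longrightarrow> y \<in> carrier A \<Longrightarrow> smult A c (x + y) = smult A c x + smult A c y"
  using cba_axioms[THEN conjunct2, THEN conjunct2, THEN conjunct2, THEN conjunct1] by blast

lemma mult_add_left: "x \<in> carrier A \<Longrightarrow> y \<in> carrier A \<Longrightarrow> z \<in> carrier A \<Longrightarrow>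
    mult A (x + y) z = mult A x z + mult A y z"
  and mult_add_right: "x \<in> carrier A \<Longrightarrow> y \<in> carrier A \<Longrightarrow> z \<in> carrier A \<Longrightarrow>
    mult A x (y + z) = mult A x y + mult A x z"
  and mult_smult_left: "x \<in> carrier A \<Longrightarrow> y \<in> carrier A \<Longrightarrow> mult A (smult A c x) y = smult A c (mult A x y)"
  and mult_smult_right: "x \<in> carrier A \<Longrightarrow> y \<in> carrier A \<Longrightarrow> mult A x (smult A c y) = smult A c (mult A x y)"
  using cba_axioms[THEN conjunct2, THEN conjunct2, THEN conjunct2, THEN conjunct2, THEN conjunct1]
  by blast+

lemma nrm_nonneg: "x \<in> carrier A \<Longrightarrow> 0 \<le> nrm A x"
  and nrm_eq_0: "x \<in> carrier A \<Longrightarrow> nrm A x = 0 \<longleftrightarrow> x = 0"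
  and nrm_smult: "x \<in> carrier A \<Longrightarrow> nrm A (smult A c x) = cmod c * nrm A x"
  and nrm_mult: "x \<in> carrier A \<Longrightarrow> y \<in> carrier A \<Longrightarrow> nrm A (mult A x y) \<le> nrm A x * nrm A y"
  using cba_axioms[THEN conjunct2, THEN conjunct2, THEN conjunct2, THEN conjunct2, THEN conjunct2,
      THEN conjunct1]
  by blast+

lemma nrm_0: "nrm A 0 = 0"
  using nrm_eq_0 zero_closed by blast

lemma smult_0: "smult A c 0 = 0"
  using smult_add[OF zero_closed zero_closed, of c] by simp

lemma mult_0_left: "x \<in> carrier A \<Longrightarrow> mult A 0 x = 0"
  using mult_add_left[OF zero_closed zero_closed, of x] by simp

lemma mult_0_right: "x \<in> carrier A \<Longrightarrow> mult A x 0 = 0"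
  using mult_add_right[OF _ zero_closed zero_closed, of x] by simp

lemma sum_closed: "(\<And>k. k \<in> K \<Longrightarrow> g k \<in> carrier A) \<Longrightarrow> sum g K \<in> carrier A"
  by (induction K rule: infinite_finite_induct) (auto intro: zero_closed add_closed)

lemmas dba_axioms = dba[unfolded dual_banach_algebra_def]

lemma predual_dual: "f \<in> predual A \<Longrightarrow> f \<in> dual_space A"
  using dba_axioms[THEN conjunct2, THEN conjunct1] by blast

lemma predual_zero: "0 \<in> predual A"
  by (rule dba_axioms[THEN conjunct2, THEN conjunct2, THEN conjunct1])

lemma predual_add: "f \<in> predual A \<Longrightarrow> g \<in> predual A \<Longrightarrow> f + g \<in> predual A"
  using dba_axioms[THEN conjunct2, THEN conjunct2, THEN conjunct2, THEN conjunct1] by blast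

lemma predual_fsmult: "f \<in> predual A \<Longrightarrow> fsmult c f \<in> predual A"
  using dba_axioms[THEN conjunct2, THEN conjunct2, THEN conjunct2, THEN conjunct2, THEN conjunct1] by blast

lemma predual_norm: "a \<in> carrier A \<Longrightarrow> nrm A a = Sup {cmod (f a) | f. f \<in> predual A \<and> dnorm A f \<le> 1}"
  by (rule dba_axioms[THEN conjunct2, THEN conjunct2, THEN conjunct2, THEN conjunct2, THEN conjunct2, THEN conjunct2, THEN conjunct2, THEN conjunct1, rule_format])

lemma predual_represents: "blf (predual A) fsmult (dnorm A) \<Phi> \<Longrightarrow> \<exists>a\<in>carrier A. \<forall>f\<in>predual A. \<Phi> f = f a"
  by (rule dba_axioms[THEN conjunct2, THEN conjunct2, THEN conjunct2, THEN conjunct2, THEN conjunct2, THEN conjunct2, THEN conjunct2, THEN conjunct2, rule_format])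

lemma dual_add: "f \<in> dual_space A \<Longrightarrow> x \<in> carrier A \<Longrightarrow> y \<in> carrier A \<Longrightarrow> f (x + y) = f x + f y"
  and dual_smult: "f \<in> dual_space A \<Longrightarrow> x \<in> carrier A \<Longrightarrow> f (smult A c x) = c * f x"
  and dual_outside: "f \<in> dual_space A \<Longrightarrow> x \<notin> carrier A \<Longrightarrow> f x = 0"
  unfolding dual_space_def blf_def by blast+

lemma dual_zero: "f \<in> dual_space A \<Longrightarrow> f 0 = 0"
  unfolding dual_space_def using blf_zero zero_closed by blast

lemma dual_sum:
  assumes "f \<in> dual_space A" "finite K" "\<And>k. k \<in> K \<Longrightarrow> g k \<in> carrier A"
  shows "f (sum g K) = (\<Sum>k\<in>K. f (g k))"
  using blf_sum[of "carrier A" "smult A" "nrm A" f K g] assms zero_closed add_closed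
  unfolding dual_space_def by blast

lemma dual_bound:
  assumes "f \<in> dual_space A"
  obtains K where "0 \<le> K" "\<And>x. x \<in> carrier A \<Longrightarrow> cmod (f x) \<le> K * nrm A x"
proof -
  obtain K where K: "\<And>x. x \<in> carrier A \<Longrightarrow> cmod (f x) \<le> K * nrm A x"
    using assms unfolding dual_space_def blf_def by blast
  have "cmod (f x) \<le> \<bar>K\<bar> * nrm A x" if "x \<in> carrier A" for x
    using K[OF that] mult_right_mono[OF abs_ge_self[of K] nrm_nonneg[OF that]] by linarith
  then show ?thesis using that[of "\<bar>K\<bar>"] by simp
qed

section \<open>Norms of functionals and of bilinear forms\<close>

lemma normalize:
  assumes "x \<in> carrier A" "x \<noteq> 0"
  shows "smult A (of_real (1 / nrm A x)) x \<in> carrier A" "nrm A (smult A (of_real (1 / nrm A x)) x) = 1"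
    "nrm A x > 0"
proof -
  show "nrm A x > 0" using nrm_nonneg[OF assms(1)] nrm_eq_0[OF assms(1)] assms(2) by linarith
  then show "nrm A (smult A (of_real (1 / nrm A x)) x) = 1"
    unfolding nrm_smult[OF assms(1)] norm_of_real by simp
qed (simp add: smult_closed assms)

text \<open>For nonzero \<open>x\<close> this is the supremum tested at the normalized vector.
  Boundedness of the set of values comes first, since \<open>Sup\<close> is only informative for
  sets bounded above.\<close>

lemma dnorm_bound:
  assumes f: "f \<in> dual_space A" and x: "x \<in> carrier A"
  shows "cmod (f x) \<le> dnorm A f * nrm A x"
proof (cases "x = 0")
  case True
  then show ?thesis using dual_zero[OF f] nrm_0 by simp
next
  case False
  obtain K where K: "0 \<le> K" "\<And>x. x \<in> carrier A \<Longrightarrow> cmod (f x) \<le> K * nrm A x"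
    by (rule dual_bound[OF f]) blast
  have "cmod (f x) \<le> K" if "x \<in> carrier A" "nrm A x \<le> 1" for x
    using K(2)[OF that(1)] mult_left_mono[OF that(2) K(1)] by simp
  then have "bdd_above {cmod (f x) | x. x \<in> carrier A \<and> nrm A x \<le> 1}"
    by (intro bdd_aboveI[of _ K]) blast
  then have "cmod (f (smult A (of_real (1 / nrm A x)) x)) \<le> dnorm A f"
    unfolding dnorm_def
    by (intro cSup_upper) (use normalize[OF x False] in auto)
  then show ?thesis
    using normalize(3)[OF x False] by (simp add: dual_smult f x norm_mult norm_divide field_simps)
qed

lemma dnorm_nonneg:
  assumes "f \<in> dual_space A"
  shows "0 \<le> dnorm A f"
proof (cases "carrier A = {0}")
  \<comment> \<open>A trivial carrier provides no nonzero vector whose norm could be divided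
    out.\<close>
  case True
  then have "{cmod (f x) | x. x \<in> carrier A \<and> nrm A x \<le> 1} = {0}"
    using dual_zero[OF assms] nrm_0 by auto
  then show ?thesis unfolding dnorm_def by simp
next
  case False
  then obtain x where "x \<in> carrier A" "x \<noteq> 0" using zero_closed by blast
  then have "0 \<le> dnorm A f * nrm A x" "nrm A x > 0"
    using dnorm_bound[OF assms] normalize(3) norm_ge_zero order_trans by blast+
  then show ?thesis by (simp add: zero_le_mult_iff)
qed

lemma bilin_zero:
  assumes "T \<in> bilin A"
  shows "T 0 c = 0" "T c 0 = 0"
proof -
  have "T 0 c = 0 \<and> T c 0 = 0"
  proof (cases "c \<in> carrier A")
    case True
    show ?thesis
      using bilinD(1,2)[OF assms zero_closed zero_closed True] by simp
  qed (use bilin_outside[OF assms] in blast)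
  then show "T 0 c = 0" "T c 0 = 0" by auto
qed

lemma bilin_set_bdd:
  assumes "T \<in> bilin A"
  shows "bdd_above {cmod (T b c) | b c. b \<in> carrier A \<and> c \<in> carrier A \<and> nrm A b \<le> 1 \<and> nrm A c \<le> 1}"
proof -
  obtain K where K: "\<And>b c. b \<in> carrier A \<Longrightarrow> c \<in> carrier A \<Longrightarrow> cmod (T b c) \<le> K * nrm A b * nrm A c"
    using bilin_bound[OF assms] by blast
  have "cmod (T b c) \<le> \<bar>K\<bar>"
    if "b \<in> carrier A" "c \<in> carrier A" "nrm A b \<le> 1" "nrm A c \<le> 1" for b c
  proof -
    have n: "0 \<le> nrm A b" "0 \<le> nrm A c" using that nrm_nonneg by auto
    have "cmod (T b c) \<le> K * nrm A b * nrm A c" using K that by blast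
    also have "\<dots> \<le> \<bar>K\<bar> * (nrm A b * nrm A c)"
      using mult_right_mono[OF abs_ge_self[of K], of "nrm A b * nrm A c"] n by (simp add: mult.assoc)
    also have "\<dots> \<le> \<bar>K\<bar> * 1"
      by (intro mult_left_mono mult_le_one) (use n that in auto)
    finally show ?thesis by simp
  qed
  then show ?thesis by (intro bdd_aboveI[of _ "\<bar>K\<bar>"]) blast
qed

lemma bnorm_upper:
  assumes "T \<in> bilin A" "b \<in> carrier A" "c \<in> carrier A" "nrm A b \<le> 1" "nrm A c \<le> 1"
  shows "cmod (T b c) \<le> bnorm A T"
  unfolding bnorm_def
  using assms(2-) by (intro cSup_upper[OF _ bilin_set_bdd[OF assms(1)]] CollectI exI[of _ b] exI[of _ c]) simp

lemma bnorm_nonneg: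
  assumes "T \<in> bilin A"
  shows "0 \<le> bnorm A T"
proof -
  have "cmod (T 0 0) \<le> bnorm A T"
    by (intro bnorm_upper assms zero_closed) (simp_all add: nrm_0)
  then show ?thesis using norm_ge_zero order_trans by blast
qed

text \<open>The two arguments are normalized separately, after splitting off the case where one of
  them is 0.\<close>

lemma bnorm_bound:
  assumes T: "T \<in> bilin A" and b: "b \<in> carrier A" and c: "c \<in> carrier A"
  shows "cmod (T b c) \<le> bnorm A T * nrm A b * nrm A c"
proof (cases "b = 0 \<or> c = 0")
  case True
  then show ?thesis using bilin_zero[OF T] nrm_0 by auto
next
  case False
  let ?b = "smult A (of_real (1 / nrm A b)) b" and ?c = "smult A (of_real (1 / nrm A c)) c"
  have n: "?b \<in> carrier A" "?c \<in> carrier A" "nrm A ?b = 1" "nrm A ?c = 1" "nrm A b > 0" "nrm A c > 0"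
    using normalize b c False by blast+
  have "cmod (T ?b ?c) \<le> bnorm A T"
    using bnorm_upper[OF T n(1,2)] n(3,4) by simp
  moreover have "T ?b ?c = of_real (1 / nrm A b) * (of_real (1 / nrm A c) * T b c)"
    using bilinD(3)[OF T b b n(2)] bilinD(4)[OF T c c b] by metis
  ultimately have "1 / nrm A b * (1 / nrm A c * cmod (T b c)) \<le> bnorm A T"
    using n(5,6) by (simp add: norm_mult norm_divide)
  then show ?thesis
    using n(5,6) by (simp add: field_simps)
qed

section \<open>The adjoint of multiplication and the element induced by a functional on
  forms\<close>

lemma pistar_bilin:
  assumes f: "f \<in> dual_space A"
  shows "pistar A f \<in> bilin A"
proof -
  obtain K where K: "0 \<le> K" "\<And>x. x \<in> carrier A \<Longrightarrow> cmod (f x) \<le> K * nrm A x"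
    by (rule dual_bound[OF f]) blast
  show ?thesis
  proof (rule bilinI[where K=K])
    fix b c assume bc: "b \<in> carrier A" "c \<in> carrier A"
    have "cmod (f (mult A b c)) \<le> K * nrm A (mult A b c)"
      using K bc mult_closed by blast
    also have "\<dots> \<le> K * (nrm A b * nrm A c)"
      by (intro mult_left_mono nrm_mult bc K)
    finally show "cmod (pistar A f b c) \<le> K * nrm A b * nrm A c"
      using bc by (simp add: pistar_def mult.assoc)
  qed (auto simp: pistar_def add_closed smult_closed mult_closed mult_add_left mult_add_right
        mult_smult_left mult_smult_right dual_add[OF f] dual_smult[OF f])
qed

text \<open>Submultiplicativity keeps products of vectors from the unit ball in the unit
  ball.\<close>

lemma bnorm_pistar_le:
  assumes f: "f \<in> dual_space A"
  shows "bnorm A (pistar A f) \<le> dnorm A f"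
  unfolding bnorm_def
proof (rule cSup_least)
  show "{cmod (pistar A f b c) | b c. b \<in> carrier A \<and> c \<in> carrier A \<and> nrm A b \<le> 1 \<and> nrm A c \<le> 1} \<noteq> {}"
    using zero_closed nrm_0 by force
next
  fix r
  assume "r \<in> {cmod (pistar A f b c) | b c. b \<in> carrier A \<and> c \<in> carrier A \<and> nrm A b \<le> 1 \<and> nrm A c \<le> 1}"
  then obtain b c where r: "r = cmod (f (mult A b c))"
    and bc: "b \<in> carrier A" "c \<in> carrier A" "nrm A b \<le> 1" "nrm A c \<le> 1"
    unfolding pistar_def by auto
  have "nrm A (mult A b c) \<le> 1"
    using nrm_mult[OF bc(1,2)] mult_le_one[OF bc(3) nrm_nonneg[OF bc(2)] bc(4)] by linarith
  then show "r \<le> dnorm A f"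
    unfolding r
    using dnorm_bound[OF f mult_closed[OF bc(1,2)]] mult_left_mono[OF _ dnorm_nonneg[OF f]] by fastforce
qed

text \<open>The norm of the difference is a supremum over the unit ball of the predual, where only
  the value 0 occurs.\<close>

lemma predual_separates:
  assumes x: "x \<in> carrier A" and y: "y \<in> carrier A" and eq: "\<And>f. f \<in> predual A \<Longrightarrow> f x = f y"
  shows "x = y"
proof -
  have xy: "x - y \<in> carrier A" using add_closed[OF x neg_closed[OF y]] by simp
  have "f (x - y) = 0" if "f \<in> predual A" for f
    using dual_add[OF predual_dual[OF that] xy y] eq[OF that] by simp
  \<comment> \<open>This puts the zero functional into the unit ball, so the supremum is not taken
    over the empty set.\<close>
  moreover have "dnorm A 0 = 0"
  proof -
    have "{cmod (0 x) | x. x \<in> carrier A \<and> nrm A x \<le> 1} = {0}"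
      using zero_closed nrm_0 by auto
    then show ?thesis unfolding dnorm_def by (metis (no_types) cSup_singleton)
  qed
  ultimately have "{cmod (f (x - y)) | f. f \<in> predual A \<and> dnorm A f \<le> 1} = {0}"
    using predual_zero by (auto intro!: exI[of _ 0])
  then have "nrm A (x - y) = 0" using predual_norm[OF xy] by simp
  then show ?thesis using nrm_eq_0[OF xy] by simp
qed

text \<open>Sending \<omega> to \<open>m (pistar A \<omega>)\<close> is bounded on the predual, so
  duality represents it by an element, and the predual separates points. This makes the description
  in \<open>emap\<close> meaningful.\<close>

lemma emap_ex1:
  assumes m: "m \<in> bidual A"
  shows "\<exists>!a. a \<in> carrier A \<and> (\<forall>\<omega>\<in>predual A. \<omega> a = m (pistar A \<omega>))"
proof -
  obtain K where K: "\<And>T. T \<in> bilin A \<Longrightarrow> cmod (m T) \<le> K * bnorm A T"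
    using m unfolding bidual_def blf_def by blast
  have "blf (predual A) fsmult (dnorm A) (\<lambda>\<omega>. m (pistar A \<omega>))"
    unfolding blf_def
  proof (intro conjI ballI allI exI[of _ "\<bar>K\<bar>"])
    fix f g assume fg: "f \<in> predual A" "g \<in> predual A"
    have "pistar A (f + g) = pistar A f + pistar A g"
      by (auto simp: pistar_def fun_eq_iff)
    then show "m (pistar A (f + g)) = m (pistar A f) + m (pistar A g)"
      using fg by (simp add: bidual_add[OF m] pistar_bilin predual_dual)
  next
    fix c f assume f: "f \<in> predual A"
    have "pistar A (fsmult c f) = bsmult c (pistar A f)"
      by (auto simp: pistar_def fsmult_def bsmult_def fun_eq_iff)
    then show "m (pistar A (fsmult c f)) = c * m (pistar A f)"
      using f by (simp add: bidual_bsmult[OF m] pistar_bilin predual_dual)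
  next
    fix f assume "f \<in> predual A"
    then have f: "f \<in> dual_space A" by (rule predual_dual)
    have "cmod (m (pistar A f)) \<le> K * bnorm A (pistar A f)"
      by (intro K pistar_bilin f)
    also have "\<dots> \<le> \<bar>K\<bar> * bnorm A (pistar A f)"
      by (intro mult_right_mono bnorm_nonneg pistar_bilin f) simp
    also have "\<dots> \<le> \<bar>K\<bar> * dnorm A f"
      by (intro mult_left_mono bnorm_pistar_le f) simp
    finally show "cmod (m (pistar A f)) \<le> \<bar>K\<bar> * dnorm A f" .
  qed
  then obtain a where "a \<in> carrier A" "\<forall>\<omega>\<in>predual A. m (pistar A \<omega>) = \<omega> a"
    using predual_represents by blast
  then show ?thesis
    by (intro ex1I[of _ a]) (auto intro: predual_separates)
qed

text \<open>A weak* neighbourhood of 0 on which \<phi> stays in the unit disc contains the common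
  kernel of finitely many predual functionals. A linear functional bounded on a subspace vanishes
  there, so \<phi> is a combination of these functionals on the carrier. The value 0 elsewhere
  follows the convention of \<open>dual_space\<close>.\<close>

lemma wstar_continuous_functional_in_predual:
  assumes lin: "\<And>x y. x \<in> carrier A \<Longrightarrow> y \<in> carrier A \<Longrightarrow> \<phi> (x + y) = \<phi> x + \<phi> y"
      "\<And>c x. x \<in> carrier A \<Longrightarrow> \<phi> (smult A c x) = c * \<phi> x"
    and cont: "continuous_map (wstar_top A) euclidean \<phi>"
  shows "(\<lambda>x. if x \<in> carrier A then \<phi> x else 0) \<in> predual A"
proof -
  define U where "U = {x \<in> carrier A. \<phi> x \<in> ball 0 1}"
  have "openin (wstar_top A) U"
    using cont unfolding continuous_map_def U_def topspace_wstar[OF predual_zero]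
    by (metis open_ball open_openin)
  moreover have "\<phi> 0 = 0"
    using lin(1)[OF zero_closed zero_closed] by simp
  then have "0 \<in> U" using zero_closed by (simp add: U_def)
  ultimately obtain F where F: "finite F" "F \<subseteq> predual A"
    "\<forall>y\<in>carrier A. (\<forall>f\<in>F. f y = f 0) \<longrightarrow> y \<in> U"
    using wstar_nbhd_contains_level_set by metis
  have F0: "f 0 = 0" if "f \<in> F" for f
    using that F(2) dual_zero predual_dual by blast
  have "\<phi> x = 0" if x: "x \<in> carrier A" "\<forall>f\<in>F. f x = 0" for x
  proof (rule ccontr)
    assume nz: "\<phi> x \<noteq> 0"
    \<comment> \<open>Scaling brings the value of \<phi> to 1, which is outside the open unit
      disc.\<close>
    let ?y = "smult A (1 / \<phi> x) x"
    have "f ?y = f 0" if "f \<in> F" for f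
      using dual_smult[OF predual_dual[OF subsetD[OF F(2) that]] x(1)] bspec[OF x(2) that] F0[OF that] by simp
    then have "?y \<in> U" using F(3) smult_closed[OF x(1)] by blast
    then show False using lin(2)[OF x(1)] nz by (simp add: U_def)
  qed
  then have "\<exists>h\<in>predual A. \<forall>x\<in>carrier A. \<phi> x = h x"
    by (intro vanishing_on_common_kernel_in_span[where F=F and sm="smult A"])
      (use lin F in \<open>auto intro: add_closed smult_closed predual_zero predual_add predual_fsmult
        dual_add dual_smult predual_dual\<close>)
  then obtain h where h: "h \<in> predual A" "\<forall>x\<in>carrier A. \<phi> x = h x" by blast
  then have "(\<lambda>x. if x \<in> carrier A then \<phi> x else 0) = h"
    using dual_outside[OF predual_dual[OF h(1)]] by auto
  then show ?thesis using h(1) by simp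
qed

end

section \<open>Upper triangular matrices\<close>

lemma sum_fun_apply: "(\<Sum>k\<in>K. g k) x = (\<Sum>k\<in>K. g k x)"
  by (induction K rule: infinite_finite_induct) auto

locale up_cba = dual_cba A for A :: "('a::ab_group_add, 'b) cba_scheme" +
  fixes I :: "'i::linorder set"
  assumes finite_index: "finite I"
begin

abbreviation "B \<equiv> UP I A"

section \<open>Entries, operations and norm of matrices\<close>

lemma up_carrier: "carrier B = {M. \<forall>i j. if i \<in> I \<and> j \<in> I \<and> i \<le> j then M i j \<in> carrier A else M i j = 0}"
  by (simp add: UP_def)

lemma up_entry: "M \<in> carrier B \<Longrightarrow> M i j \<in> carrier A"
  unfolding up_carrier using zero_closed by (metis (mono_tags, lifting) mem_Collect_eq)

lemma up_entry_zero: "M \<in> carrier B \<Longrightarrow> \<not> (i \<in> I \<and> j \<in> I \<and> i \<le> j) \<Longrightarrow> M i j = 0"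
  unfolding up_carrier by (metis (mono_tags, lifting) mem_Collect_eq)

lemma up_below_diagonal: "M \<in> carrier B \<Longrightarrow> j < i \<Longrightarrow> M i j = 0"
  using up_entry_zero by (meson leD)

lemma up_carrierI:
  assumes "\<And>i j. i \<in> I \<Longrightarrow> j \<in> I \<Longrightarrow> i \<le> j \<Longrightarrow> M i j \<in> carrier A"
    and "\<And>i j. \<not> (i \<in> I \<and> j \<in> I \<and> i \<le> j) \<Longrightarrow> M i j = 0"
  shows "M \<in> carrier B"
  unfolding up_carrier using assms by simp

lemma up_smult: "M \<in> carrier B \<Longrightarrow> smult B c M i j = smult A c (M i j)"
  using up_entry_zero[of M i j] by (auto simp: UP_def smult_0)

lemma up_mult: "i \<in> I \<Longrightarrow> j \<in> I \<Longrightarrow> mult B M N i j = (\<Sum>k\<in>I. mult A (M i k) (N k j))"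
  by (simp add: UP_def)

lemma up_nrm: "nrm B M = (\<Sum>i\<in>I. \<Sum>j\<in>I. nrm A (M i j))"
  by (simp add: UP_def)

lemma up_zero_closed: "0 \<in> carrier B"
  by (rule up_carrierI) (simp_all add: zero_closed)

lemma up_add_closed: "M \<in> carrier B \<Longrightarrow> N \<in> carrier B \<Longrightarrow> M + N \<in> carrier B"
  by (rule up_carrierI) (simp_all add: add_closed up_entry up_entry_zero)

lemma up_neg_closed: "M \<in> carrier B \<Longrightarrow> - M \<in> carrier B"
  by (rule up_carrierI) (simp_all add: neg_closed up_entry up_entry_zero)

lemma up_smult_closed: "M \<in> carrier B \<Longrightarrow> smult B c M \<in> carrier B"
  by (rule up_carrierI) (simp_all add: up_smult smult_closed up_entry up_entry_zero smult_0)

lemma up_mult_closed: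
  assumes M: "M \<in> carrier B" and N: "N \<in> carrier B"
  shows "mult B M N \<in> carrier B"
proof (rule up_carrierI)
  fix i j assume "i \<in> I" "j \<in> I"
  then show "mult B M N i j \<in> carrier A"
    unfolding up_mult[OF \<open>i \<in> I\<close> \<open>j \<in> I\<close>] by (intro sum_closed mult_closed up_entry M N)
next
  fix i j assume *: "\<not> (i \<in> I \<and> j \<in> I \<and> i \<le> j)"
  \<comment> \<open>For \<open>j < i\<close> each index \<open>k\<close> satisfies
    \<open>k < i\<close> or \<open>j < k\<close>, so one of the two factors lies below the
    diagonal.\<close>
  have "mult A (M i k) (N k j) = 0" if "j < i" for k
  proof (cases "i \<le> k")
    case True
    then have "N k j = 0" using that by (intro up_entry_zero[OF N]) auto
    then show ?thesis using mult_0_right[OF up_entry[OF M]] by simp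
  next
    case False
    then have "M i k = 0" by (intro up_entry_zero[OF M]) auto
    then show ?thesis using mult_0_left[OF up_entry[OF N]] by simp
  qed
  then show "mult B M N i j = 0"
    using * by (auto simp: UP_def not_le)
qed

lemma up_nrm_nonneg: "M \<in> carrier B \<Longrightarrow> 0 \<le> nrm B M"
  unfolding up_nrm by (intro sum_nonneg nrm_nonneg up_entry)

lemma up_nrm_zero: "nrm B 0 = 0"
  by (simp add: up_nrm nrm_0)

lemma nrm_entry_le:
  assumes M: "M \<in> carrier B"
  shows "nrm A (M i j) \<le> nrm B M"
proof (cases "i \<in> I \<and> j \<in> I")
  case True
  have "nrm A (M i j) \<le> (\<Sum>j\<in>I. nrm A (M i j))"
    using True finite_index by (intro member_le_sum[of j I "\<lambda>j. nrm A (M i j)"]) (auto intro: nrm_nonneg up_entry M)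
  also have "\<dots> \<le> nrm B M"
    unfolding up_nrm
    using True finite_index
    by (intro member_le_sum[of i I "\<lambda>i. \<Sum>j\<in>I. nrm A (M i j)"]) (auto intro!: sum_nonneg nrm_nonneg up_entry M)
  finally show ?thesis .
next
  case False
  then have "M i j = 0" using up_entry_zero[OF M] by blast
  then show ?thesis using up_nrm_nonneg[OF M] by (simp add: nrm_0)
qed

section \<open>Entry functionals and the predual of the matrix algebra\<close>

definition entry :: "'i \<Rightarrow> 'i \<Rightarrow> ('a \<Rightarrow> complex) \<Rightarrow> ('i \<Rightarrow> 'i \<Rightarrow> 'a) \<Rightarrow> complex" where
  "entry i j h = (\<lambda>M. if M \<in> carrier B then h (M i j) else 0)"

lemma entry_dual:
  assumes h: "h \<in> dual_space A"
  shows "entry i j h \<in> dual_space B"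
proof -
  obtain K where K: "0 \<le> K" "\<And>x. x \<in> carrier A \<Longrightarrow> cmod (h x) \<le> K * nrm A x"
    by (rule dual_bound[OF h]) blast
  have "cmod (entry i j h M) \<le> K * nrm B M" if M: "M \<in> carrier B" for M
    using K(2)[OF up_entry[OF M, of i j]] mult_left_mono[OF nrm_entry_le[OF M, of i j] K(1)] M
    by (simp add: entry_def)
  then show ?thesis
    unfolding dual_space_def blf_def mem_Collect_eq
    by (intro conjI ballI allI exI[of _ K] impI)
      (simp_all add: entry_def up_add_closed up_smult_closed up_smult up_entry dual_add[OF h] dual_smult[OF h])
qed

lemma up_predual: "predual B = {\<Phi>. \<exists>f. (\<forall>i\<in>I. \<forall>j\<in>I. i \<le> j \<longrightarrow> f i j \<in> predual A) \<and>
    \<Phi> = (\<lambda>M. if M \<in> carrier B then (\<Sum>i\<in>I. \<Sum>j\<in>I. if i \<le> j then f i j (M i j) else 0) else 0)}"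
  unfolding up_carrier by (simp add: UP_def)

text \<open>The double sum in \<open>predual\<close> collapses when \<open>h\<close> sits in one
  position and 0 in all others. Positions outside the triangle are allowed: there the entry is 0,
  and so is the value of \<open>h\<close>.\<close>

lemma entry_predual:
  assumes h: "h \<in> predual A"
  shows "entry i j h \<in> predual B"
proof -
  define f where "f = (\<lambda>k l. if k = i \<and> l = j then h else 0)"
  have "(\<Sum>k\<in>I. \<Sum>l\<in>I. if k \<le> l then f k l (M k l) else 0) = h (M i j)" if M: "M \<in> carrier B" for M
  proof -
    have "(\<Sum>k\<in>I. \<Sum>l\<in>I. if k \<le> l then f k l (M k l) else 0)
      = (\<Sum>k\<in>I. \<Sum>l\<in>I. if l = j then if k = i then if i \<le> j then h (M i j) else 0 else 0 else 0)"
      by (intro sum.cong refl) (auto simp: f_def)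
    also have "\<dots> = (\<Sum>k\<in>I. if k = i then if i \<le> j \<and> j \<in> I then h (M i j) else 0 else 0)"
      by (intro sum.cong refl) (simp add: finite_index)
    also have "\<dots> = (if i \<in> I \<and> j \<in> I \<and> i \<le> j then h (M i j) else 0)"
      by (simp add: finite_index)
    also have "\<dots> = h (M i j)"
      using up_entry_zero[OF M, of i j] dual_zero[OF predual_dual[OF h]] by auto
    finally show ?thesis .
  qed
  moreover have "f k l \<in> predual A" for k l
    using h predual_zero by (simp add: f_def)
  ultimately show ?thesis
    unfolding up_predual by (auto simp: entry_def fun_eq_iff intro!: exI[of _ f])
qed

lemma up_predual_zero: "0 \<in> predual B"
proof -
  have "entry undefined undefined 0 = 0" by (auto simp: entry_def)
  then show ?thesis using entry_predual[OF predual_zero] by metis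
qed

text \<open>The coefficients are put into the predual without any condition on the indices, and the
  double sum becomes a single sum over pairs, ready for finite additivity.\<close>

lemma up_predual_decompose:
  assumes "\<Phi> \<in> predual B"
  obtains f where "\<And>i j. f i j \<in> predual A" "\<Phi> = (\<Sum>p\<in>I \<times> I. entry (fst p) (snd p) (f (fst p) (snd p)))"
proof -
  obtain f where f: "\<And>i j. i \<in> I \<Longrightarrow> j \<in> I \<Longrightarrow> i \<le> j \<Longrightarrow> f i j \<in> predual A"
    and \<Phi>: "\<Phi> = (\<lambda>M. if M \<in> carrier B then (\<Sum>i\<in>I. \<Sum>j\<in>I. if i \<le> j then f i j (M i j) else 0) else 0)"
    using assms unfolding up_predual by blast
  \<comment> \<open>Coefficients off the triangle are not controlled by the definition of the
    predual, so they are reset to 0.\<close>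
  define g where "g = (\<lambda>i j. if i \<in> I \<and> j \<in> I \<and> i \<le> j then f i j else 0)"
  have "\<Phi> M = (\<Sum>p\<in>I \<times> I. entry (fst p) (snd p) (g (fst p) (snd p))) M" for M
  proof -
    have "\<Phi> M = (\<Sum>i\<in>I. \<Sum>j\<in>I. entry i j (g i j) M)"
      unfolding \<Phi> by (auto simp: entry_def g_def intro!: sum.cong)
    also have "\<dots> = (\<Sum>p\<in>I \<times> I. entry (fst p) (snd p) (g (fst p) (snd p)) M)"
      by (simp add: sum.cartesian_product split_def)
    finally show ?thesis by (simp add: sum_fun_apply)
  qed
  moreover have "g i j \<in> predual A" for i j
    using f predual_zero by (simp add: g_def)
  ultimately show ?thesis using that by blast
qed

text \<open>Chosen so that the \<open>(i,j)\<close> entry of a product pairs with \<open>h\<close> as the lift of \<open>\<pi>\<^sup>*h\<close>.\<close>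

definition lift :: "'i \<Rightarrow> 'i \<Rightarrow> ('a \<Rightarrow> 'a \<Rightarrow> complex) \<Rightarrow> ('i \<Rightarrow> 'i \<Rightarrow> 'a) \<Rightarrow> ('i \<Rightarrow> 'i \<Rightarrow> 'a) \<Rightarrow> complex" where
  "lift i j T = (\<lambda>b c. if b \<in> carrier B \<and> c \<in> carrier B then \<Sum>k\<in>I. T (b i k) (c k j) else 0)"

text \<open>Each of the \<open>card I\<close> summands is estimated with the full matrix norms in
  place of the norms of the entries.\<close>

lemma lift_bound:
  assumes T: "T \<in> bilin A" and b: "b \<in> carrier B" and c: "c \<in> carrier B"
  shows "cmod (lift i j T b c) \<le> real (card I) * bnorm A T * nrm B b * nrm B c"
proof -
  have "cmod (lift i j T b c) \<le> (\<Sum>k\<in>I. cmod (T (b i k) (c k j)))"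
    using b c by (simp add: lift_def norm_sum)
  also have "\<dots> \<le> (\<Sum>k\<in>I. bnorm A T * nrm B b * nrm B c)"
  proof (rule sum_mono)
    fix k
    have "cmod (T (b i k) (c k j)) \<le> bnorm A T * nrm A (b i k) * nrm A (c k j)"
      by (intro bnorm_bound T up_entry b c)
    also have "\<dots> \<le> bnorm A T * nrm B b * nrm B c"
      by (intro mult_mono nrm_entry_le mult_nonneg_nonneg bnorm_nonneg nrm_nonneg up_nrm_nonneg up_entry T b c) simp
    finally show "cmod (T (b i k) (c k j)) \<le> bnorm A T * nrm B b * nrm B c" .
  qed
  finally show ?thesis by (simp add: mult.assoc)
qed

lemma lift_bilin:
  assumes T: "T \<in> bilin A"
  shows "lift i j T \<in> bilin B"
proof (rule bilinI[OF _ _ _ _ _ lift_bound[OF T]])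
qed (auto simp: lift_def up_add_closed up_smult_closed up_smult up_entry
      bilinD[OF T up_entry up_entry up_entry] bilinD(3,4)[OF T up_entry _ up_entry]
      sum.distrib sum_distrib_left)

text \<open>Each pair of indices turns a functional for the matrix algebra into one for
  \<open>A\<close>; these supply the entries of the matrix attached to \<open>m\<close>.\<close>

lemma lift_bidual:
  assumes m: "m \<in> bidual B"
  shows "(\<lambda>T. m (lift i j T)) \<in> bidual A"
proof (rule bidual_pullback[OF m])
  fix T assume T: "T \<in> bilin A"
  show "\<bar>bnorm B (lift i j T)\<bar> \<le> real (card I) * bnorm A T"
    unfolding bnorm_def[of B]
  proof (rule cSup_abs_le)
    show "{cmod (lift i j T b c) |b c. b \<in> carrier B \<and> c \<in> carrier B \<and> nrm B b \<le> 1 \<and> nrm B c \<le> 1} \<noteq> {}"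
      using up_zero_closed up_nrm_zero by force
  next
    fix r
    assume "r \<in> {cmod (lift i j T b c) |b c. b \<in> carrier B \<and> c \<in> carrier B \<and> nrm B b \<le> 1 \<and> nrm B c \<le> 1}"
    then obtain b c where r: "r = cmod (lift i j T b c)"
      and bc: "b \<in> carrier B" "c \<in> carrier B" "nrm B b \<le> 1" "nrm B c \<le> 1" by blast
    have "r \<le> real (card I) * bnorm A T * (nrm B b * nrm B c)"
      unfolding r using lift_bound[OF T bc(1,2)] by (simp add: mult.assoc)
    also have "\<dots> \<le> real (card I) * bnorm A T * 1"
      by (intro mult_left_mono mult_le_one up_nrm_nonneg bc mult_nonneg_nonneg bnorm_nonneg T) simp
    finally show "\<bar>r\<bar> \<le> real (card I) * bnorm A T" by (simp add: r)
  qed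
qed (auto simp: lift_bilin, auto simp: lift_def bsmult_def fun_eq_iff sum.distrib sum_distrib_left)

lemma pistar_entry:
  assumes h: "h \<in> dual_space A" and ij: "i \<in> I" "j \<in> I"
  shows "pistar B (entry i j h) = lift i j (pistar A h)"
proof -
  have "h (\<Sum>k\<in>I. mult A (b i k) (c k j)) = (\<Sum>k\<in>I. pistar A h (b i k) (c k j))"
    if "b \<in> carrier B" "c \<in> carrier B" for b c
    by (subst dual_sum[OF h finite_index]) (auto simp: pistar_def mult_closed up_entry that)
  then show ?thesis
    by (auto simp: pistar_def[of B] entry_def lift_def fun_eq_iff up_mult_closed up_mult ij)
qed

text \<open>The matrix is assembled from the elements of \<open>A\<close> that represent
  \<open>m\<close> after \<open>lift i j\<close>. Entry functionals span the predual, so the pairing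
  only has to be checked on them, and they also give uniqueness.\<close>

lemma up_emap_ex1:
  assumes m: "m \<in> bidual B"
  shows "\<exists>!M. M \<in> carrier B \<and> (\<forall>\<omega>\<in>predual B. \<omega> M = m (pistar B \<omega>))"
proof -
  have "\<exists>a. a \<in> carrier A \<and> (\<forall>\<omega>\<in>predual A. \<omega> a = m (lift i j (pistar A \<omega>)))" for i j
    using emap_ex1[OF lift_bidual[OF m]] by blast
  then obtain a where a: "\<And>i j. a i j \<in> carrier A"
    "\<And>i j \<omega>. \<omega> \<in> predual A \<Longrightarrow> \<omega> (a i j) = m (lift i j (pistar A \<omega>))"
    by metis
  define M where "M = (\<lambda>i j. if i \<in> I \<and> j \<in> I \<and> i \<le> j then a i j else 0)"
  have M: "M \<in> carrier B" by (rule up_carrierI) (auto simp: M_def a)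
  have entry_M: "entry i j h M = m (pistar B (entry i j h))" if h: "h \<in> predual A" and ij: "i \<in> I" "j \<in> I" for i j h
  proof (cases "i \<le> j")
    case True
    then show ?thesis
      using M ij a(2)[OF h] by (simp add: entry_def[of i j] pistar_entry[OF predual_dual[OF h] ij, unfolded entry_def] M_def)
  next
    case False
    \<comment> \<open>An entry functional below the diagonal is zero on upper triangular matrices,
      in agreement with the entry 0 chosen in \<open>M\<close>.\<close>
    have "entry i j h = 0"
      using False dual_zero[OF predual_dual[OF h]] by (auto simp: entry_def fun_eq_iff up_below_diagonal not_le)
    then have "entry i j h M = 0" "pistar B (entry i j h) = 0" by (simp_all add: pistar_def fun_eq_iff)
    \<comment> \<open>The empty sum shows that \<open>m\<close> vanishes at 0.\<close>
    then show ?thesis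
      using bidual_sum(1)[OF m, of "{}"] by simp
  qed
  have "\<omega> M = m (pistar B \<omega>)" if \<omega>_predual: "\<omega> \<in> predual B" for \<omega>
  proof -
    obtain f where f: "\<And>i j. f i j \<in> predual A"
      and \<omega>: "\<omega> = (\<Sum>p\<in>I \<times> I. entry (fst p) (snd p) (f (fst p) (snd p)))"
      by (rule up_predual_decompose[OF \<omega>_predual]) blast
    have "pistar B \<omega> = (\<Sum>p\<in>I \<times> I. pistar B (entry (fst p) (snd p) (f (fst p) (snd p))))"
      unfolding \<omega> by (auto simp: pistar_def sum_fun_apply fun_eq_iff)
    moreover have "m (\<Sum>p\<in>I \<times> I. pistar B (entry (fst p) (snd p) (f (fst p) (snd p))))
      = (\<Sum>p\<in>I \<times> I. m (pistar B (entry (fst p) (snd p) (f (fst p) (snd p)))))"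
      by (intro bidual_sum[OF m]) (auto simp: finite_index pistar_entry predual_dual f lift_bilin pistar_bilin)
    ultimately show ?thesis
      unfolding \<omega> by (auto simp: sum_fun_apply entry_M f intro!: sum.cong)
  qed
  moreover have "N = M" if N: "N \<in> carrier B" "\<forall>\<omega>\<in>predual B. \<omega> N = m (pistar B \<omega>)" for N
  proof (intro ext predual_separates up_entry N(1) M)
    fix i j f assume "f \<in> predual A"
    then have "entry i j f N = entry i j f M"
      using N(2) calculation entry_predual by metis
    then show "f (N i j) = f (M i j)" using N(1) M by (simp add: entry_def)
  qed
  ultimately show ?thesis using M by blast
qed

lemma emap_up:
  assumes "m \<in> bidual B"
  shows "emap B m \<in> carrier B" "\<omega> \<in> predual B \<Longrightarrow> \<omega> (emap B m) = m (pistar B \<omega>)"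
  using theI'[OF up_emap_ex1[OF assms]] unfolding emap_def by blast+

section \<open>The obstruction produced by two distinct indices\<close>

definition unit_matrix :: "'i \<Rightarrow> 'i \<Rightarrow> 'a \<Rightarrow> 'i \<Rightarrow> 'i \<Rightarrow> 'a" where
  "unit_matrix i j a = (\<lambda>k l. if k = i \<and> l = j then a else 0)"

lemma unit_matrix_closed:
  "i \<in> I \<Longrightarrow> j \<in> I \<Longrightarrow> i \<le> j \<Longrightarrow> a \<in> carrier A \<Longrightarrow> unit_matrix i j a \<in> carrier B"
  by (rule up_carrierI) (auto simp: unit_matrix_def zero_closed)

text \<open>The character is taken as a member of the predual, in place of a weak*-continuous map,
  because the entry functionals built from it have to lie in the predual of
  \<open>B\<close>.\<close>

lemma up_not_amenable:
  assumes \<phi>: "\<phi> \<in> predual A" and e: "e \<in> carrier A" "\<phi> e \<noteq> 0"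
    and \<phi>_mult: "\<And>x y. x \<in> carrier A \<Longrightarrow> y \<in> carrier A \<Longrightarrow> \<phi> (mult A x y) = \<phi> x * \<phi> y"
    and pn: "p \<in> I" "n \<in> I" "p < n"
  shows "\<not> johnson_pseudo_connes_amenable B"
proof
  assume "johnson_pseudo_connes_amenable B"
  then obtain F where F: "F \<noteq> bot"
    "eventually (\<lambda>m. m \<in> bidual B \<and> (\<forall>a\<in>carrier B. \<forall>T\<in>swc B. m (ract B T a) = m (lact B a T))) F"
    "\<And>a e. a \<in> carrier B \<Longrightarrow> 0 < e \<Longrightarrow> eventually (\<lambda>m. nrm B (mult B (emap B m) a - a) < e) F"
    unfolding johnson_pseudo_connes_amenable_def by blast
  note \<phi>_dual = predual_dual[OF \<phi>]
  define w where "w = entry n n \<phi>"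
  \<comment> \<open>\<open>S p\<close> is the obstructing form; the \<open>S k\<close> are the
    components of its right translates, and \<open>S n\<close> will turn out to be
    \<open>pistar B w\<close>.\<close>
  define S where "S = (\<lambda>k b c. entry k n \<phi> b * w c)"
  have S: "S k \<in> bilin B" for k
    unfolding S_def w_def by (intro bilin_product entry_dual \<phi>_dual)
  have \<phi>_row: "\<phi> (mult B a b i j) = (\<Sum>k\<in>I. \<phi> (a i k) * \<phi> (b k j))"
    if "a \<in> carrier B" "b \<in> carrier B" "i \<in> I" "j \<in> I" for a b i j
    unfolding up_mult[OF that(3,4)]
    by (subst dual_sum[OF \<phi>_dual finite_index]) (simp_all add: mult_closed up_entry that \<phi>_mult)
  have w_mult: "w (mult B a b) = w a * w b" if ab: "a \<in> carrier B" "b \<in> carrier B" for a b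
  proof -
    \<comment> \<open>Row \<open>n\<close> of \<open>a\<close> vanishes to the left of the diagonal
      and column \<open>n\<close> of \<open>b\<close> vanishes below it, so only
      \<open>k = n\<close> survives.\<close>
    have "(\<Sum>k\<in>I. \<phi> (a n k) * \<phi> (b k n)) = (\<Sum>k\<in>I. if k = n then \<phi> (a n n) * \<phi> (b n n) else 0)"
    proof (intro sum.cong refl)
      fix k
      consider "k = n" | "k < n" | "n < k" by force
      then show "\<phi> (a n k) * \<phi> (b k n) = (if k = n then \<phi> (a n n) * \<phi> (b n n) else 0)"
        using dual_zero[OF \<phi>_dual] by cases (auto simp: up_below_diagonal ab)
    qed
    then show ?thesis
      using ab pn finite_index by (simp add: w_def entry_def up_mult_closed \<phi>_row)
  qed
  have w: "w \<in> predual B" unfolding w_def by (intro entry_predual \<phi>)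
  \<comment> \<open>The left action multiplies only the second argument, where \<open>w\<close> is
    multiplicative.\<close>
  have lact_S: "lact B a (S p) = bsmult (w a) (S p)" if "a \<in> carrier B" for a
    using that by (auto simp: lact_def bsmult_def S_def w_mult fun_eq_iff) (auto simp: w_def entry_def)
  \<comment> \<open>The right action multiplies the first argument by \<open>a\<close>; expanding
    the (p,n) entry of the product over \<open>k\<close> gives a combination of the
    \<open>S k\<close>.\<close>
  have ract_S: "ract B (S p) a = (\<Sum>k\<in>I. bsmult (entry p k \<phi> a) (S k))" if "a \<in> carrier B" for a
    using that pn
    by (auto simp: ract_def bsmult_def S_def fun_eq_iff sum_fun_apply sum_distrib_right mult.assoc
        entry_def up_mult_closed \<phi>_row w_def)
  have "S p \<in> swc B"
    unfolding swc_def mem_Collect_eq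
  proof (intro conjI S)
    show "continuous_map (wstar_top B) (weak_top B) (\<lambda>a. lact B a (S p))"
      by (rule finite_rank_wstar_weak_continuous[where K="{()}" and g="\<lambda>_. w" and S="\<lambda>_. S p"])
        (simp_all add: up_predual_zero w S lact_S)
    show "continuous_map (wstar_top B) (weak_top B) (ract B (S p))"
      by (rule finite_rank_wstar_weak_continuous[where K=I and g="\<lambda>k. entry p k \<phi>" and S=S])
        (simp_all add: up_predual_zero finite_index entry_predual \<phi> S ract_S)
  qed
  obtain K where K: "\<And>M. M \<in> carrier B \<Longrightarrow> cmod (w M) \<le> K * nrm B M"
    using entry_dual[OF \<phi>_dual] unfolding w_def dual_space_def blf_def by blast
  define u where "u = unit_matrix n n e"
  have u: "u \<in> carrier B" "w u = \<phi> e"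
    using unit_matrix_closed[of n n e] pn e by (auto simp: u_def w_def entry_def) (simp add: unit_matrix_def)
  \<comment> \<open>Since \<open>K\<close> may be zero or negative, the denominator is made
    positive. An error below this tolerance has a \<open>w\<close>-value smaller in modulus than
    \<phi> e.\<close>
  have "cmod (\<phi> e) / (\<bar>K\<bar> + 1) > 0" using e by simp
  from eventually_happens'[OF F(1) eventually_conj[OF F(2) F(3)[OF u(1) this]]]
  obtain m where m: "m \<in> bidual B"
    and comm: "\<And>a T. a \<in> carrier B \<Longrightarrow> T \<in> swc B \<Longrightarrow> m (ract B T a) = m (lact B a T)"
    and approx: "nrm B (mult B (emap B m) u - u) < cmod (\<phi> e) / (\<bar>K\<bar> + 1)"
    by blast
  have v: "unit_matrix p n e \<in> carrier B"
    using pn e by (intro unit_matrix_closed) auto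
  have entry_v: "entry i j \<phi> (unit_matrix p n e) = (if i = p \<and> j = n then \<phi> e else 0)" for i j
    using v dual_zero[OF \<phi>_dual] by (simp add: entry_def) (simp add: unit_matrix_def)
  have "m (ract B (S p) (unit_matrix p n e)) = (\<Sum>k\<in>I. entry p k \<phi> (unit_matrix p n e) * m (S k))"
    unfolding ract_S[OF v] by (subst bidual_sum(1)[OF m finite_index]) (simp_all add: S bilin_bsmult bidual_bsmult[OF m])
  \<comment> \<open>Only the (p,n) entry of the test matrix is nonzero, which singles out
    \<open>S n\<close>.\<close>
  also have "\<dots> = (\<Sum>k\<in>I. if k = n then \<phi> e * m (S n) else 0)"
    by (intro sum.cong refl) (simp add: entry_v)
  also have "\<dots> = \<phi> e * m (S n)" using pn finite_index by simp
  finally have "\<phi> e * m (S n) = m (lact B (unit_matrix p n e) (S p))"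
    using comm[OF v \<open>S p \<in> swc B\<close>] by simp
  \<comment> \<open>The (n,n) entry of the test matrix is 0 because \<open>p\<close> differs from
    \<open>n\<close>, so the scalar in front of \<open>S p\<close> is 0.\<close>
  also have "\<dots> = 0"
    unfolding lact_S[OF v] bidual_bsmult[OF m S] using pn by (simp add: w_def entry_v)
  finally have "m (S n) = 0" using e by simp
  \<comment> \<open>This is multiplicativity of \<open>w\<close>, as the first factor of
    \<open>S n\<close> is \<open>w\<close> itself.\<close>
  moreover have "pistar B w = S n"
    by (auto simp: pistar_def S_def fun_eq_iff w_mult) (auto simp: w_def entry_def)
  ultimately have "w (emap B m) = 0"
    using emap_up(2)[OF m w] by simp
  let ?d = "mult B (emap B m) u - u"
  have d: "?d \<in> carrier B"
    using up_add_closed[OF up_mult_closed[OF emap_up(1)[OF m] u(1)] up_neg_closed[OF u(1)]] by simp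
  \<comment> \<open>\<open>blf\<close> records additivity, so the value at the difference is found
    by adding \<open>u\<close> back.\<close>
  have "w (?d + u) = w ?d + w u"
    using entry_dual[OF \<phi>_dual] d u(1) unfolding w_def dual_space_def blf_def by blast
  then have "w ?d = - \<phi> e"
    using w_mult[OF emap_up(1)[OF m] u(1)] \<open>w (emap B m) = 0\<close> u(2) by (simp add: eq_neg_iff_add_eq_0)
  then have "cmod (\<phi> e) \<le> K * nrm B ?d" using K[OF d] by simp
  also have "\<dots> \<le> (\<bar>K\<bar> + 1) * nrm B ?d"
    by (intro mult_right_mono up_nrm_nonneg d) simp
  also have "\<dots> < cmod (\<phi> e)"
    using approx by (simp add: field_simps)
  finally show False by simp
qed

end

section \<open>Transport along isometric isomorphisms\<close>

text \<open>The source enters through closure conditions and the unique existence behind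
  \<open>emap\<close>, instead of the axioms of a dual Banach algebra, so that the matrix algebra
  can be the source as well as the target.\<close>

locale cba_iso =
  fixes A :: "('a::ab_group_add, 'c) cba_scheme" and B :: "('b::ab_group_add, 'd) cba_scheme"
    and \<sigma> :: "'a \<Rightarrow> 'b" and \<tau> :: "'b \<Rightarrow> 'a"
  assumes add_closed: "x \<in> carrier A \<Longrightarrow> y \<in> carrier A \<Longrightarrow> x + y \<in> carrier A"
    and neg_closed: "x \<in> carrier A \<Longrightarrow> - x \<in> carrier A"
    and smult_closed: "x \<in> carrier A \<Longrightarrow> smult A s x \<in> carrier A"
    and mult_closed: "x \<in> carrier A \<Longrightarrow> y \<in> carrier A \<Longrightarrow> mult A x y \<in> carrier A"
    and \<sigma>_closed: "x \<in> carrier A \<Longrightarrow> \<sigma> x \<in> carrier B"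
    and \<tau>_closed: "z \<in> carrier B \<Longrightarrow> \<tau> z \<in> carrier A"
    and \<tau>_\<sigma>: "x \<in> carrier A \<Longrightarrow> \<tau> (\<sigma> x) = x"
    and \<sigma>_\<tau>: "z \<in> carrier B \<Longrightarrow> \<sigma> (\<tau> z) = z"
    and \<sigma>_add: "x \<in> carrier A \<Longrightarrow> y \<in> carrier A \<Longrightarrow> \<sigma> (x + y) = \<sigma> x + \<sigma> y"
    and \<sigma>_smult: "x \<in> carrier A \<Longrightarrow> \<sigma> (smult A s x) = smult B s (\<sigma> x)"
    and \<sigma>_mult: "x \<in> carrier A \<Longrightarrow> y \<in> carrier A \<Longrightarrow> \<sigma> (mult A x y) = mult B (\<sigma> x) (\<sigma> y)"
    and \<sigma>_nrm: "x \<in> carrier A \<Longrightarrow> nrm B (\<sigma> x) = nrm A x"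
    and predual_zero: "0 \<in> predual A" "0 \<in> predual B"
    and \<sigma>_predual: "f \<in> predual B \<Longrightarrow> (\<lambda>x. if x \<in> carrier A then f (\<sigma> x) else 0) \<in> predual A"
    and \<tau>_predual: "g \<in> predual A \<Longrightarrow> (\<lambda>y. if y \<in> carrier B then g (\<tau> y) else 0) \<in> predual B"
    and emap_ex1: "m \<in> bidual A \<Longrightarrow> \<exists>!a. a \<in> carrier A \<and> (\<forall>\<omega>\<in>predual A. \<omega> a = m (pistar A \<omega>))"
begin

text \<open>Forms are pulled back from \<open>B\<close> to \<open>A\<close>, so functionals on forms
  travel from \<open>A\<close> to \<open>B\<close>.\<close>

definition pull :: "('b \<Rightarrow> 'b \<Rightarrow> complex) \<Rightarrow> 'a \<Rightarrow> 'a \<Rightarrow> complex" where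
  "pull T = (\<lambda>b c. if b \<in> carrier A \<and> c \<in> carrier A then T (\<sigma> b) (\<sigma> c) else 0)"

lemma pull_bilin:
  assumes T: "T \<in> bilin B"
  shows "pull T \<in> bilin A"
proof -
  obtain K where K: "\<And>b c. b \<in> carrier B \<Longrightarrow> c \<in> carrier B \<Longrightarrow> cmod (T b c) \<le> K * nrm B b * nrm B c"
    using bilin_bound[OF T] by blast
  show ?thesis
  proof (rule bilinI[where K=K])
    fix b c assume "b \<in> carrier A" "c \<in> carrier A"
    then show "cmod (pull T b c) \<le> K * nrm A b * nrm A c"
      using K[OF \<sigma>_closed \<sigma>_closed] by (simp add: pull_def \<sigma>_nrm)
  qed (auto simp: pull_def add_closed smult_closed \<sigma>_add \<sigma>_smult \<sigma>_closed
      bilinD(1,2)[OF T] bilinD(3,4)[OF T _ \<sigma>_closed])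
qed

text \<open>The isometry matches the unit balls, so both suprema are taken over the same
  set.\<close>

lemma bnorm_pull: "bnorm A (pull T) = bnorm B T"
proof -
  have "{cmod (pull T b c) |b c. b \<in> carrier A \<and> c \<in> carrier A \<and> nrm A b \<le> 1 \<and> nrm A c \<le> 1} =
    {cmod (T b c) |b c. b \<in> carrier B \<and> c \<in> carrier B \<and> nrm B b \<le> 1 \<and> nrm B c \<le> 1}" (is "?L = ?R")
  proof (intro equalityI subsetI)
    fix r assume "r \<in> ?L"
    then obtain b c where "r = cmod (pull T b c)" "b \<in> carrier A" "c \<in> carrier A" "nrm A b \<le> 1" "nrm A c \<le> 1"
      by blast
    then show "r \<in> ?R"
      by (intro CollectI exI[of _ "\<sigma> b"] exI[of _ "\<sigma> c"]) (simp add: pull_def \<sigma>_closed \<sigma>_nrm)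
  next
    fix r assume "r \<in> ?R"
    then obtain b c where "r = cmod (T b c)" "b \<in> carrier B" "c \<in> carrier B" "nrm B b \<le> 1" "nrm B c \<le> 1"
      by blast
    then show "r \<in> ?L"
      using \<sigma>_nrm[OF \<tau>_closed, of b] \<sigma>_nrm[OF \<tau>_closed, of c]
      by (intro CollectI exI[of _ "\<tau> b"] exI[of _ "\<tau> c"]) (simp add: pull_def \<tau>_closed \<sigma>_\<tau>)
  qed
  then show ?thesis by (simp add: bnorm_def)
qed

lemma pull_bidual:
  assumes m: "m \<in> bidual A"
  shows "(\<lambda>T. m (pull T)) \<in> bidual B"
proof -
  obtain K where K: "\<And>T. T \<in> bilin A \<Longrightarrow> cmod (m T) \<le> K * bnorm A T"
    using m unfolding bidual_def blf_def by blast
  have "pull (S + T) = pull S + pull T" "pull (bsmult s T) = bsmult s (pull T)" for S T s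
    by (auto simp: pull_def bsmult_def fun_eq_iff)
  then show ?thesis
    unfolding bidual_def blf_def mem_Collect_eq
    using K[OF pull_bilin]
    by (intro conjI exI[of _ K]) (simp_all add: bidual_add[OF m] bidual_bsmult[OF m] pull_bilin bnorm_pull)
qed

text \<open>Composing a predual functional of \<open>B\<close> with \<sigma> gives one of
  \<open>A\<close>, so subbasic sets pull back to open sets.\<close>

lemma \<sigma>_wstar_continuous: "continuous_map (wstar_top A) (wstar_top B) \<sigma>"
  unfolding wstar_top_def[of B]
proof (rule continuous_on_generated_topo)
  fix W assume "W \<in> {{x \<in> carrier B. f x \<in> U} |f U. f \<in> predual B \<and> open U}"
  then obtain f U where W: "W = {x \<in> carrier B. f x \<in> U}" and f: "f \<in> predual B" and U: "open U"
    by (elim CollectE exE conjE)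
  have "\<sigma> -` W \<inter> topspace (wstar_top A)
    = {x \<in> topspace (wstar_top A). (if x \<in> carrier A then f (\<sigma> x) else 0) \<in> U}"
    unfolding topspace_wstar[OF predual_zero(1)] W by (auto simp: \<sigma>_closed)
  then show "openin (wstar_top A) (\<sigma> -` W \<inter> topspace (wstar_top A))"
    using predual_wstar_continuous[OF predual_zero(1) \<sigma>_predual[OF f]] U
    unfolding continuous_map_def by simp
next
  show "\<sigma> ` topspace (wstar_top A) \<subseteq> \<Union> {{x \<in> carrier B. f x \<in> U} |f U. f \<in> predual B \<and> open U}"
    unfolding topology_generated_by_topspace[symmetric] wstar_top_def[symmetric]
      topspace_wstar[OF predual_zero(1)] topspace_wstar[OF predual_zero(2)]
    by (simp add: image_subset_iff \<sigma>_closed)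
qed

text \<open>Composition with \<open>pull\<close> takes \<open>bidual A\<close> into
  \<open>bidual B\<close>, so every test functional stays continuous.\<close>

lemma pull_weak_continuous: "continuous_map (weak_top B) (weak_top A) pull"
  by (rule continuous_map_weakI)
    (auto simp: topspace_weak pull_bilin intro: bidual_weak_continuous pull_bidual)

lemma lact_pull: "a \<in> carrier A \<Longrightarrow> lact A a (pull T) = pull (lact B (\<sigma> a) T)"
  by (auto simp: lact_def pull_def fun_eq_iff mult_closed \<sigma>_mult \<sigma>_closed)

lemma ract_pull: "a \<in> carrier A \<Longrightarrow> ract A (pull T) a = pull (ract B T (\<sigma> a))"
  by (auto simp: ract_def pull_def fun_eq_iff mult_closed \<sigma>_mult \<sigma>_closed)

text \<open>By the intertwining relations, each action map for \<open>pull T\<close> is a composite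
  of \<sigma>, the action map for \<open>T\<close> and \<open>pull\<close>, all continuous in the
  respective topologies.\<close>

lemma pull_swc:
  assumes "T \<in> swc B"
  shows "pull T \<in> swc A"
proof -
  have T: "T \<in> bilin B" "continuous_map (wstar_top B) (weak_top B) (\<lambda>a. lact B a T)"
    "continuous_map (wstar_top B) (weak_top B) (ract B T)"
    using assms unfolding swc_def by auto
  have c: "continuous_map (wstar_top A) (weak_top A) (\<lambda>a. pull (lact B (\<sigma> a) T))"
    "continuous_map (wstar_top A) (weak_top A) (\<lambda>a. pull (ract B T (\<sigma> a)))"
    using continuous_map_compose[OF continuous_map_compose[OF \<sigma>_wstar_continuous T(2)] pull_weak_continuous]
      continuous_map_compose[OF continuous_map_compose[OF \<sigma>_wstar_continuous T(3)] pull_weak_continuous]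
    by (simp_all add: o_def)
  have "continuous_map (wstar_top A) (weak_top A) (\<lambda>a. lact A a (pull T))"
    "continuous_map (wstar_top A) (weak_top A) (\<lambda>a. ract A (pull T) a)"
    using continuous_map_eq[OF c(1)] continuous_map_eq[OF c(2)]
    by (simp_all add: topspace_wstar[OF predual_zero(1)] lact_pull ract_pull)
  then show ?thesis using pull_bilin[OF T(1)] by (simp add: swc_def)
qed

text \<open>Both elements are determined by their pairings with the predual of \<open>B\<close>,
  which correspond to pairings with the predual of \<open>A\<close>.\<close>

lemma emap_pull:
  assumes m: "m \<in> bidual A"
  shows "emap B (\<lambda>T. m (pull T)) = \<sigma> (emap A m)" "emap A m \<in> carrier A"
proof -
  have pull_pistar: "pull (pistar B \<omega>) = pistar A (\<lambda>x. if x \<in> carrier A then \<omega> (\<sigma> x) else 0)" for \<omega>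
    by (auto simp: pull_def pistar_def fun_eq_iff mult_closed \<sigma>_mult \<sigma>_closed)
  have u: "emap A m \<in> carrier A" "\<And>\<omega>. \<omega> \<in> predual A \<Longrightarrow> \<omega> (emap A m) = m (pistar A \<omega>)"
    using theI'[OF emap_ex1[OF m]] unfolding emap_def by blast+
  show "emap A m \<in> carrier A" by (rule u)
  show "emap B (\<lambda>T. m (pull T)) = \<sigma> (emap A m)"
    unfolding emap_def[of B]
  proof (rule the_equality)
    show "\<sigma> (emap A m) \<in> carrier B \<and> (\<forall>\<omega>\<in>predual B. \<omega> (\<sigma> (emap A m)) = m (pull (pistar B \<omega>)))"
      using u(1) u(2)[OF \<sigma>_predual] by (simp add: \<sigma>_closed pull_pistar)
  next
    fix b assume b: "b \<in> carrier B \<and> (\<forall>\<omega>\<in>predual B. \<omega> b = m (pull (pistar B \<omega>)))"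
    have "\<omega> (\<tau> b) = m (pistar A \<omega>)" if \<omega>: "\<omega> \<in> predual A" for \<omega>
    proof -
      \<comment> \<open>Moving \<omega> to \<open>B\<close> along \<tau> gives a test functional
        that returns to \<omega> on the carrier when composed with \<sigma>.\<close>
      let ?g = "\<lambda>y. if y \<in> carrier B then \<omega> (\<tau> y) else 0"
      have "\<omega> (\<tau> b) = m (pull (pistar B ?g))"
        using bspec[OF conjunct2[OF b] \<tau>_predual[OF \<omega>]] b by simp
      moreover have "pull (pistar B ?g) = pistar A \<omega>"
        unfolding pull_pistar by (auto simp: pistar_def fun_eq_iff mult_closed \<sigma>_closed \<tau>_\<sigma>)
      ultimately show ?thesis by simp
    qed
    then have "\<tau> b = emap A m"
      using emap_ex1[OF m] u b \<tau>_closed by blast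
    then show "b = \<sigma> (emap A m)" using b \<sigma>_\<tau> by metis
  qed
qed

lemma amenable_transport:
  assumes "johnson_pseudo_connes_amenable A"
  shows "johnson_pseudo_connes_amenable B"
proof -
  obtain F where F: "F \<noteq> bot"
    "eventually (\<lambda>m. m \<in> bidual A \<and> (\<forall>a\<in>carrier A. \<forall>T\<in>swc A. m (ract A T a) = m (lact A a T))) F"
    "\<And>a e. a \<in> carrier A \<Longrightarrow> 0 < e \<Longrightarrow> eventually (\<lambda>m. nrm A (mult A (emap A m) a - a) < e) F"
    using assms unfolding johnson_pseudo_connes_amenable_def by blast
  \<comment> \<open>The net is pushed forward along composition with \<open>pull\<close>.\<close>
  define G where "G = filtermap (\<lambda>m T. m (pull T)) F"
  have "G \<noteq> bot" using F(1) by (simp add: G_def filtermap_bot_iff)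
  moreover have "eventually (\<lambda>m. m \<in> bidual B \<and>
      (\<forall>a\<in>carrier B. \<forall>T\<in>swc B. m (ract B T a) = m (lact B a T))) G"
    unfolding G_def eventually_filtermap
    using F(2)
  proof eventually_elim
    case (elim m)
    \<comment> \<open>Writing \<open>a\<close> as the image of \<open>\<tau> a\<close> turns this
      into the commutation relation in \<open>A\<close> for \<open>pull T\<close>.\<close>
    have "m (pull (ract B T a)) = m (pull (lact B a T))" if "a \<in> carrier B" "T \<in> swc B" for a T
      using elim that ract_pull[OF \<tau>_closed, of a T] lact_pull[OF \<tau>_closed, of a T] pull_swc \<tau>_closed
      by (simp add: \<sigma>_\<tau>) metis
    then show ?case using elim pull_bidual by simp
  qed
  moreover have "eventually (\<lambda>m. nrm B (mult B (emap B m) a - a) < e) G"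
    if a: "a \<in> carrier B" and e: "0 < e" for a e
    unfolding G_def eventually_filtermap
    using F(2) F(3)[OF \<tau>_closed[OF a] e]
  proof eventually_elim
    case (elim m)
    then have m: "m \<in> bidual A" by blast
    let ?d = "mult A (emap A m) (\<tau> a) - \<tau> a"
    have d: "?d \<in> carrier A"
      using add_closed[OF mult_closed[OF emap_pull(2)[OF m] \<tau>_closed[OF a]] neg_closed[OF \<tau>_closed[OF a]]] by simp
    have "\<sigma> ?d + \<sigma> (\<tau> a) = \<sigma> (mult A (emap A m) (\<tau> a))"
      using \<sigma>_add[OF d \<tau>_closed[OF a]] by simp
    \<comment> \<open>The error in \<open>B\<close> is the image of the error in \<open>A\<close>,
      so the two have equal norm.\<close>
    then have "mult B (\<sigma> (emap A m)) a - a = \<sigma> ?d"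
      by (simp add: \<sigma>_mult emap_pull(2)[OF m] \<tau>_closed a \<sigma>_\<tau> eq_diff_eq diff_eq_eq)
    then show ?case
      using elim \<sigma>_nrm[OF d] by (simp add: emap_pull(1)[OF m])
  qed
  ultimately show ?thesis
    unfolding johnson_pseudo_connes_amenable_def by blast
qed

end

section \<open>The case of a single index, and the equivalence\<close>

lemma up_singleton_amenable_iff:
  fixes A :: "('a::ab_group_add, 'b) cba_scheme" and i :: "'i::linorder"
  assumes "dual_banach_algebra A"
  shows "johnson_pseudo_connes_amenable (UP {i} A) \<longleftrightarrow> johnson_pseudo_connes_amenable A"
proof -
  interpret up_cba A "{i}"
    using assms by unfold_locales auto
  have u: "unit_matrix i i x \<in> carrier B" if "x \<in> carrier A" for x
    using that by (intro unit_matrix_closed) auto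
  have u_entry: "unit_matrix i i x i i = x" for x
    by (simp add: unit_matrix_def)
  have eq: "unit_matrix i i (M i i) = M" if "M \<in> carrier B" for M
    using up_entry_zero[OF that] by (auto simp: unit_matrix_def fun_eq_iff)
  have eqI: "M = N" if "M \<in> carrier B" "N \<in> carrier B" "M i i = N i i" for M N
    by (rule trans[OF eq[OF that(1), symmetric]]) (simp only: that(3) eq[OF that(2)])
  have entry_f: "(\<lambda>y. if y \<in> carrier B then f (y i i) else 0) \<in> predual B" if "f \<in> predual A" for f
    using entry_predual[OF that, of i i] by (simp add: entry_def)
  have u_f: "(\<lambda>x. if x \<in> carrier A then \<Phi> (unit_matrix i i x) else 0) \<in> predual A"
    if "\<Phi> \<in> predual B" for \<Phi>
  proof -
    \<comment> \<open>Over a single index the decomposition has one coefficient, which is the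
      functional sought.\<close>
    obtain f where f: "\<And>k l. f k l \<in> predual A"
      and \<Phi>: "\<Phi> = (\<Sum>p\<in>{i} \<times> {i}. entry (fst p) (snd p) (f (fst p) (snd p)))"
      by (rule up_predual_decompose[OF \<open>\<Phi> \<in> predual B\<close>]) blast
    have "(\<lambda>x. if x \<in> carrier A then \<Phi> (unit_matrix i i x) else 0) = f i i"
      using dual_outside[OF predual_dual[OF f]] by (auto simp: \<Phi> entry_def u u_entry)
    then show ?thesis using f by simp
  qed
  \<comment> \<open>In the two directions \<open>up_emap_ex1\<close> and \<open>emap_ex1\<close>
    respectively supply the condition on \<open>emap\<close> for the source.\<close>
  have to_A: "cba_iso B A (\<lambda>M. M i i) (unit_matrix i i)"
    by unfold_locales
      (simp_all add: up_add_closed up_neg_closed up_smult_closed up_mult_closed up_entry u u_entry eq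
        up_smult up_mult up_nrm up_predual_zero predual_zero entry_f u_f up_emap_ex1)
  have of_A: "cba_iso A B (unit_matrix i i) (\<lambda>M. M i i)"
    by unfold_locales
      (auto simp: add_closed neg_closed smult_closed mult_closed up_entry u u_entry eq
        up_smult up_mult up_nrm up_predual_zero predual_zero entry_f u_f emap_ex1
        intro!: eqI up_add_closed up_smult_closed up_mult_closed)
  show ?thesis
    using cba_iso.amenable_transport[OF to_A] cba_iso.amenable_transport[OF of_A] by blast
qed

theorem theorem3p3:
  fixes A :: "'a::ab_group_add cba" and \<phi> :: "'a \<Rightarrow> complex" and I :: "'i::linorder set"
  assumes "dual_banach_algebra A"
    and "character A \<phi>" and "continuous_map (wstar_top A) euclidean \<phi>"
    and "finite I" and "I \<noteq> {}"
  shows "johnson_pseudo_connes_amenable (UP I A) \<longleftrightarrow>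
           johnson_pseudo_connes_amenable A \<and> card I = 1"
proof (cases "card I = 1")
  case True
  then obtain i where "I = {i}" by (rule card_1_singletonE)
  then show ?thesis using up_singleton_amenable_iff[OF assms(1)] by simp
next
  case False
  interpret up_cba A I
    using assms by unfold_locales auto
  \<comment> \<open>Nonemptiness rules out cardinality 0, so a cardinality other than 1 leaves two
    distinct elements, which the total order arranges as \<open>p < n\<close>.\<close>
  obtain x where "x \<in> I" using assms by blast
  moreover have "I \<noteq> {x}" using False by auto
  ultimately obtain y where "y \<in> I" "y \<noteq> x" by blast
  then obtain p n where pn: "p \<in> I" "n \<in> I" "p < n"
    using \<open>x \<in> I\<close> by (metis linorder_less_linear)
  \<comment> \<open>A character is unrestricted off the carrier, whereas members of the predual
    vanish there.\<close>
  define \<psi> where "\<psi> = (\<lambda>x. if x \<in> carrier A then \<phi> x else 0)"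
  have "\<psi> \<in> predual A"
    unfolding \<psi>_def
    using assms(2,3) unfolding character_def by (intro wstar_continuous_functional_in_predual) blast+
  moreover obtain e where "e \<in> carrier A" "\<psi> e \<noteq> 0"
    using assms(2) unfolding character_def \<psi>_def by auto
  moreover have "\<psi> (mult A x y) = \<psi> x * \<psi> y" if "x \<in> carrier A" "y \<in> carrier A" for x y
    using assms(2) that mult_closed unfolding character_def \<psi>_def by simp
  ultimately show ?thesis
    using up_not_amenable[OF _ _ _ _ pn] False by blast
qed

end
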